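(* Let $X=\langle X_m\rangle_{m\ge0}$, $Y=\langle Y_n\rangle_{n\ge0}$ and $Z=\langle Z_k\rangle_{k\ge0}$ be independent simple random walks in the lattice $\mathbb Z^3$, with arbitrary fixed starting points. Denote by $L_Z(X)$ the "partially loop-erased" path obtained from $X$ by erasing any cycle that starts (and ends) at a node in $Z$ (that is, at a vertex visited by the walk $Z$), where the erasure is made when the cycle is created. Then the (setwise) triple intersection $L_Z(X)\cap Y\cap Z$ is almost surely infinite.
   Context: Paths are identified with the sets of vertices they visit when taking intersections. The chronological erasure defining $L_Z(X)$ is made precise as follows. Define finite paths $\gamma_0,\gamma_1,\dots$ by $\gamma_0:=\langle X_0\rangle$ and, given $\gamma_m=\langle w_0,\dots,w_\ell\rangle$: if $X_{m+1}\in\{Z_k : k\ge0\}$ and $X_{m+1}=w_i$ for some $0\le i\le\ell$ (there is at most one such $i$), then $\gamma_{m+1}:=\langle w_0,\dots,w_i\rangle$; otherwise $\gamma_{m+1}:=\langle w_0,\dots,w_\ell,X_{m+1}\rangle$. Since $X$ is transient, almost surely each initial segment of $\gamma_m$ stabilizes as $m\to\infty$, and $L_Z(X)$ is the limiting infinite sequence. *)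

theory Defs
  imports "HOL-Probability.Probability"
begin

definition unit_steps :: "(int ^ 3) set" where
  "unit_steps = {axis i s |i s. s = 1 \<or> s = -1}"

definition simple_random_walk ::
  "'w measure \<Rightarrow> (nat \<Rightarrow> 'w \<Rightarrow> int ^ 3) \<Rightarrow> int ^ 3 \<Rightarrow> bool" where
  "simple_random_walk M S x \<longleftrightarrow>
     (\<forall>n. S n \<in> M \<rightarrow>\<^sub>M count_space UNIV) \<and>
     (AE \<omega> in M. S 0 \<omega> = x) \<and>
     prob_space.indep_vars M (\<lambda>_. count_space UNIV) (\<lambda>n \<omega>. S (Suc n) \<omega> - S n \<omega>) UNIV \<and>
     (\<forall>n. distr M (count_space UNIV) (\<lambda>\<omega>. S (Suc n) \<omega> - S n \<omega>)
          = measure_pmf (pmf_of_set unit_steps))"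

definition independent_walks ::
  "'w measure \<Rightarrow> (nat \<Rightarrow> 'w \<Rightarrow> int ^ 3) \<Rightarrow> (nat \<Rightarrow> 'w \<Rightarrow> int ^ 3) \<Rightarrow> (nat \<Rightarrow> 'w \<Rightarrow> int ^ 3) \<Rightarrow> bool"
where
  "independent_walks M X Y Z \<longleftrightarrow>
     prob_space.indep_vars M (\<lambda>_. \<Pi>\<^sub>M n\<in>UNIV. count_space UNIV)
       (\<lambda>i \<omega> n. ([X, Y, Z] ! i) n \<omega>) {..<3}"

text \<open>
  Chronological erasure of the cycles of the path \<open>x\<close> based at a vertex of \<open>A\<close>: the list
  \<open>erased_path A x m\<close> is what is left after \<open>m\<close> steps. A vertex of \<open>A\<close> occurs at most once
  in this list (see \<open>distinct_filter_erased_path\<close> below), so the index chosen by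
  \<open>LEAST\<close> is the only candidate.
\<close>

primrec erased_path :: "'a set \<Rightarrow> (nat \<Rightarrow> 'a) \<Rightarrow> nat \<Rightarrow> 'a list" where
  "erased_path A x 0 = [x 0]"
| "erased_path A x (Suc m) =
     (let w = erased_path A x m; v = x (Suc m)
      in if v \<in> A \<and> v \<in> set w
         then take (Suc (LEAST i. i < length w \<and> w ! i = v)) w
         else w @ [v])"

lemma distinct_filter_erased_path: "distinct (filter (\<lambda>v. v \<in> A) (erased_path A x m))"
proof (induction m)
  case 0
  show ?case by simp
next
  case (Suc m)
  have "distinct (filter P (take k w))" if "distinct (filter P w)"
    for P k and w :: "'a list"
    using that by (metis append_take_drop_id distinct_append filter_append)
  with Suc show ?case by (auto simp: Let_def)
qed

text \<open>
  The limit of the lists \<open>erased_path A x m\<close> as \<open>m\<close> tends to infinity. The description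
  determines \<open>v\<close> only for those \<open>k\<close> at which the entries stabilize; all other \<open>k\<close> give
  one and the same unspecified value. If some entry stabilizes then so do all earlier ones,
  because an entry can change only when the path is truncated to length at most its index. Hence
  if the range of \<open>partial_loop_erasure A x\<close> is infinite, then every initial segment
  stabilizes and the limit is a genuine infinite path.
\<close>

definition partial_loop_erasure :: "'a set \<Rightarrow> (nat \<Rightarrow> 'a) \<Rightarrow> nat \<Rightarrow> 'a" where
  "partial_loop_erasure A x k =
     (THE v. \<forall>\<^sub>F m in sequentially. k < length (erased_path A x m) \<and> erased_path A x m ! k = v)"

end

theory Submission
  imports Defs
begin

text \<open>
  Let \<open>G\<close> be the Green function of the walk. Since \<open>G\<close> is bounded by a strictly superharmonic function
  vanishing at infinity, the walk is transient and the level sets of \<open>G\<close> are finite; since the walk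
  spends time of order \<open>T\<close> in a ball with \<open>O(T\<^bsup>3/2\<^esup>)\<close> points before time \<open>2 T\<close>, the sum of \<open>G\<^sup>3\<close> diverges.
  Finite Dirichlet energy of \<open>G\<close> makes \<open>G(v - a) / G(v)\<close> lie in \<open>[1/2, 2]\<close> outside a set on which
  \<open>G\<^sup>3\<close> is summable, so the starting points do not matter. The number of triple hits
  \<open>X\<^sub>m = Y\<^sub>k = Z\<^sub>l\<close> inside a suitable part of \<open>{G > \<eta>}\<close> then has a second moment comparable with the
  square of its mean.

  Given a triple hit at \<open>v\<close>, let \<open>\<gamma>\<close> be the erased path of \<open>X\<close> at that time. The futures of \<open>X\<close> and \<open>Y\<close>
  both start at \<open>v\<close> and are identically distributed and independent of the past and of \<open>Z\<close>. So with
  probability at least \<open>1/2\<close>, the first vertex of \<open>\<gamma>\<close> in \<open>Z\<close> hit by the future of \<open>Y\<close> does not come after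
  the first one hit by the future of \<open>X\<close>; it is then never erased. Hence a triple intersection outside
  any given finite set has probability at least \<open>2\<^bsup>-18\<^esup>\<close>, uniformly in the initial segments of
  the three walks, and Levy's zero-one argument gives probability one.
\<close>

section \<open>Simple random walk on the lattice and its Green function\<close>

text \<open>No pointwise asymptotics of \<open>green\<close> are available below: the comparison
  with \<open>potential\<close> gives only order |x|^(-1/2), far above the true |x|^(-1). Lower
  bounds are therefore proved only after summing over a ball, and double sums are controlled by
  taking a level set as the region, since such a set is not much heavier when seen from another
  centre.

  The target event is not visibly a tail event: a late visit of Z to an early vertex of X can change
  the erasure of the early part of X and of all that follows. This is why the estimate is made
  uniform in arbitrary initial segments, and why the whole path of Z is frozen before the futures of
  X and Y are resampled.

  The finite set B to be avoided has a price: X might return to B and erase there. Points v from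
  which B is hit with probability above 1/4 are discarded, so 1/2 drops to 1/4. With a factor 1/2
  for each of the three walks, the first moment is at least s/32, where s is the sum of the cubes of
  \<open>green\<close> over the region; the second moment is at most 256 s^2, and (1/32)^2 / 256 is
  the constant of the overview.\<close>

definition nbr_avg :: "(int ^ 3 \<Rightarrow> real) \<Rightarrow> int ^ 3 \<Rightarrow> real" where
  "nbr_avg h x = (\<Sum>e\<in>unit_steps. h (x + e)) / 6"

definition sq_norm :: "int ^ 3 \<Rightarrow> real" where
  "sq_norm x = (\<Sum>i\<in>UNIV. (real_of_int (x $ i))\<^sup>2)"

text \<open>The n-step transition probability from x to the origin, written as an operator power:
  all estimates before the path space are algebra of \<open>nbr_avg\<close>, and the probabilistic
  meaning enters with \<open>emeasure_walk_eq\<close>.\<close>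

definition ret_prob :: "nat \<Rightarrow> int ^ 3 \<Rightarrow> real" where
  "ret_prob n = (nbr_avg ^^ n) (indicator {0})"

definition green :: "int ^ 3 \<Rightarrow> real" where
  "green x = (\<Sum>n. ret_prob n x)"

lemma unit_steps_image: "unit_steps = (\<lambda>(i, s). axis i s) ` (UNIV \<times> {1, -1})"
  by (auto simp: unit_steps_def image_iff)

lemma inj_on_axis_sign: "inj_on (\<lambda>(i :: 3, s :: int). axis i s) (UNIV \<times> {1, -1})"
  by (auto simp: inj_on_def axis_eq_axis)

lemma finite_unit_steps [simp]: "finite unit_steps"
  by (simp add: unit_steps_image)

lemma card_unit_steps: "card unit_steps = 6"
  by (simp add: unit_steps_image card_image[OF inj_on_axis_sign] card_cartesian_product)

lemma unit_steps_nonempty [simp]: "unit_steps \<noteq> {}"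
  using card_unit_steps by force

lemma sum_unit_steps:
  "(\<Sum>e\<in>unit_steps. f e) = (\<Sum>i\<in>UNIV. f (axis i 1) + f (axis i (-1)) :: 'a :: comm_monoid_add)"
  unfolding unit_steps_image sum.reindex[OF inj_on_axis_sign]
  by (subst sum.cartesian_product') (simp add: case_prod_beta flip: sum.cartesian_product)

lemma uminus_image_unit_steps: "uminus ` unit_steps = unit_steps"
proof -
  have "- e \<in> unit_steps" if "e \<in> unit_steps" for e
  proof -
    from that obtain i s where "e = axis i s" "s = 1 \<or> s = -1"
      by (auto simp: unit_steps_def)
    moreover have "- axis i s = axis i (- s)"
      by (auto simp: axis_def vec_eq_iff)
    ultimately show ?thesis by (cases "s = 1") (force simp: unit_steps_def)+
  qed
  then show ?thesis by force
qed

lemma sum_unit_steps_uminus: "(\<Sum>e\<in>unit_steps. f (- e)) = (\<Sum>e\<in>unit_steps. f e)"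
proof -
  have "(\<Sum>e\<in>unit_steps. f (- e)) = (\<Sum>e\<in>uminus ` unit_steps. f e)"
    by (subst sum.reindex) (auto simp: inj_on_def)
  then show ?thesis by (simp add: uminus_image_unit_steps)
qed

section \<open>Algebra of the averaging operator and its powers\<close>

lemma nbr_avg_const: "nbr_avg (\<lambda>_. c) = (\<lambda>_. c)"
  by (simp add: nbr_avg_def card_unit_steps fun_eq_iff)

lemma nbr_avg_mono: "(\<And>x. f x \<le> g x) \<Longrightarrow> nbr_avg f x \<le> nbr_avg g x"
  by (simp add: nbr_avg_def divide_right_mono sum_mono)

lemma nbr_avg_add: "nbr_avg (\<lambda>x. f x + g x) = (\<lambda>x. nbr_avg f x + nbr_avg g x)"
  by (simp add: nbr_avg_def fun_eq_iff sum.distrib add_divide_distrib)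

lemma nbr_avg_cmult: "nbr_avg (\<lambda>x. c * f x) = (\<lambda>x. c * nbr_avg f x)"
  by (simp add: nbr_avg_def fun_eq_iff sum_distrib_left)

lemma nbr_avg_sum: "nbr_avg (\<lambda>x. \<Sum>i\<in>I. f i x) = (\<lambda>x. \<Sum>i\<in>I. nbr_avg (f i) x)"
  by (simp add: nbr_avg_def fun_eq_iff sum_divide_distrib[symmetric] sum.swap[of _ I])

lemma nbr_avg_shift: "nbr_avg (\<lambda>x. f (x + a)) = (\<lambda>x. nbr_avg f (x + a))"
  by (simp add: nbr_avg_def fun_eq_iff ac_simps)

lemma nbr_avg_uminus: "nbr_avg (\<lambda>x. f (- x)) = (\<lambda>x. nbr_avg f (- x))"
proof
  fix x
  show "nbr_avg (\<lambda>x. f (- x)) x = nbr_avg f (- x)"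
    using sum_unit_steps_uminus[of "\<lambda>e. f (- x + e)"] by (simp add: nbr_avg_def)
qed

lemma nbr_avg_pow_mono:
  "(\<And>x. f x \<le> g x) \<Longrightarrow> (nbr_avg ^^ n) f x \<le> (nbr_avg ^^ n) g x"
proof (induction n arbitrary: x)
  case (Suc n)
  then show ?case by (simp add: nbr_avg_mono)
qed simp

lemma nbr_avg_pow_sum:
  "(nbr_avg ^^ n) (\<lambda>x. \<Sum>i\<in>I. f i x) = (\<lambda>x. \<Sum>i\<in>I. (nbr_avg ^^ n) (f i) x)"
  by (induction n) (simp_all add: nbr_avg_sum)

lemma nbr_avg_pow_shift: "(nbr_avg ^^ n) (\<lambda>x. f (x + a)) = (\<lambda>x. (nbr_avg ^^ n) f (x + a))"
  by (induction n) (simp_all add: nbr_avg_shift)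

lemma nbr_avg_pow_uminus: "(nbr_avg ^^ n) (\<lambda>x. f (- x)) = (\<lambda>x. (nbr_avg ^^ n) f (- x))"
  by (induction n) (simp_all add: nbr_avg_uminus)

lemma nbr_avg_pow_indicator:
  assumes "finite F"
  shows "(nbr_avg ^^ n) (indicator F) x = (\<Sum>v\<in>F. ret_prob n (x - v))"
proof -
  have "indicator F = (\<lambda>x. \<Sum>v\<in>F. indicator {0} (x + - v) :: real)"
  proof
    fix x
    have "(\<Sum>v\<in>F. indicator {0} (x + - v) :: real) = (\<Sum>v\<in>F. if v = x then 1 else 0)"
      by (intro sum.cong) (auto simp: indicator_def)
    also have "\<dots> = indicator F x" using assms by (simp add: indicator_def)
    finally show "indicator F x = (\<Sum>v\<in>F. indicator {0} (x + - v) :: real)" by simp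
  qed
  then show ?thesis
    using nbr_avg_pow_shift[of n "indicator {0}" "- v" for v]
    by (simp add: nbr_avg_pow_sum ret_prob_def)
qed

lemma ret_prob_0: "ret_prob 0 = indicator {0}"
  by (simp add: ret_prob_def)

lemma ret_prob_Suc: "ret_prob (Suc n) = nbr_avg (ret_prob n)"
  by (simp add: ret_prob_def)

lemma nbr_avg_pow_const: "(nbr_avg ^^ n) (\<lambda>_. c) = (\<lambda>_. c)"
  by (induction n) (simp_all add: nbr_avg_const)

lemma ret_prob_nonneg: "0 \<le> ret_prob n x"
  using nbr_avg_pow_mono[of "\<lambda>_. 0" "indicator {0}" n x]
  by (simp add: ret_prob_def nbr_avg_pow_const)

lemma ret_prob_uminus: "ret_prob n (- x) = ret_prob n x"
proof -
  have "(\<lambda>x. indicator {0} (- x)) = (indicator {0} :: int ^ 3 \<Rightarrow> real)"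
    by (auto simp: indicator_def)
  then show ?thesis
    using fun_cong[OF nbr_avg_pow_uminus[of n "indicator {0}"], of x] by (simp add: ret_prob_def)
qed

lemma sq_norm_nonneg: "0 \<le> sq_norm x"
  by (simp add: sq_norm_def sum_nonneg)

lemma sq_norm_add_axis:
  "sq_norm (x + axis i s) = sq_norm x + 2 * real_of_int (x $ i) * real_of_int s + (real_of_int s)\<^sup>2"
proof -
  have "sq_norm (x + axis i s)
      = (\<Sum>j\<in>UNIV. (real_of_int (x $ j))\<^sup>2 + (if j = i then 2 * real_of_int (x $ i) * real_of_int s + (real_of_int s)\<^sup>2 else 0))"
    unfolding sq_norm_def
    by (intro sum.cong) (auto simp: axis_def power2_eq_square algebra_simps)
  then show ?thesis by (simp add: sum.distrib sq_norm_def)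
qed

lemma nbr_avg_sq_norm: "nbr_avg sq_norm x = sq_norm x + 1"
  by (simp add: nbr_avg_def sum_unit_steps sq_norm_add_axis sum.distrib)

text \<open>The martingale |S_n|^2 - n in operator form; it supplies the diffusive scaling used in
  \<open>ret_prob_ball_ge\<close>.\<close>

lemma nbr_avg_pow_sq_norm: "(nbr_avg ^^ n) sq_norm x = sq_norm x + real n"
proof (induction n arbitrary: x)
  case (Suc n)
  then have "(nbr_avg ^^ n) sq_norm = (\<lambda>x. sq_norm x + real n)" by auto
  then show ?case by (simp add: nbr_avg_add nbr_avg_const nbr_avg_sq_norm)
qed simp

lemma abs_component_le:
  assumes "sq_norm x \<le> real (r ^ 2)"
  shows "\<bar>x $ i\<bar> \<le> int r"
proof -
  have "(real_of_int (x $ i))\<^sup>2 \<le> sq_norm x"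
    unfolding sq_norm_def by (rule member_le_sum) auto
  with assms have "(real_of_int (x $ i))\<^sup>2 \<le> (real r)\<^sup>2" by simp
  then have "\<bar>real_of_int (x $ i)\<bar> \<le> real r"
    using abs_le_square_iff[of "real_of_int (x $ i)" "real r"] by simp
  then show ?thesis by linarith
qed

lemma box_eq_image:
  "{x :: int ^ 3. \<forall>i. \<bar>x $ i\<bar> \<le> int r} = vec_lambda ` (PiE UNIV (\<lambda>_. {- int r..int r}))" (is "?L = ?R")
proof
  show "?L \<subseteq> ?R"
  proof
    fix x :: "int ^ 3" assume "x \<in> ?L"
    then have "x = vec_lambda (vec_nth x)" "vec_nth x \<in> PiE UNIV (\<lambda>_. {- int r..int r})"
      by (auto simp: abs_le_iff minus_le_iff)
    then show "x \<in> ?R" by blast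
  qed
qed (auto simp: abs_le_iff PiE_iff minus_le_iff)

lemma finite_box: "finite {x :: int ^ 3. \<forall>i. \<bar>x $ i\<bar> \<le> int r}"
  unfolding box_eq_image by (intro finite_imageI finite_PiE) auto

lemma card_box: "card {x :: int ^ 3. \<forall>i. \<bar>x $ i\<bar> \<le> int r} = (2 * r + 1) ^ 3"
proof -
  have "inj_on vec_lambda (PiE (UNIV :: 3 set) (\<lambda>_. {- int r..int r}))"
    by (auto simp: inj_on_def)
  then show ?thesis
    unfolding box_eq_image by (simp add: card_image card_PiE Suc_nat_eq_nat_zadd1 nat_add_distrib nat_mult_distrib)
qed

lemma ball_subset_box:
  "{x. sq_norm x \<le> real (r ^ 2)} \<subseteq> {x. \<forall>i. \<bar>x $ i\<bar> \<le> int r}"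
  using abs_component_le by blast

lemma finite_sq_norm_le: "finite {x. sq_norm x \<le> c}"
proof -
  obtain r :: nat where "c \<le> real r" using real_arch_simple by blast
  also have "real r \<le> real (r ^ 2)"
    by (subst of_nat_le_iff) (simp add: power2_eq_square)
  finally have "{x. sq_norm x \<le> c} \<subseteq> {x. sq_norm x \<le> real (r ^ 2)}" by auto
  then show ?thesis
    using finite_subset[OF ball_subset_box finite_box[of r]] finite_subset by blast
qed

section \<open>A superharmonic function vanishing at infinity, and transience\<close>

lemma powr_quarter_le:
  fixes b y :: real
  assumes "b > 0" "y > 0" "1 \<le> b ^ 4 * y"
  shows "y powr (-1/4) \<le> b"
proof -
  have "1 \<le> (b ^ 4 * y) powr (1/4)"
    using assms by (simp add: ge_one_powr_ge_zero)
  also have "\<dots> = b * y powr (1/4)"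
    using assms by (simp add: powr_mult powr_powr flip: powr_numeral)
  finally show ?thesis
    using assms by (simp add: powr_minus divide_simps minus_divide_left[symmetric])
qed

lemma powr_quarter_ge:
  fixes b y :: real
  assumes "b > 0" "y > 0" "b ^ 4 * y < 1"
  shows "b < y powr (-1/4)"
proof -
  have "(b ^ 4 * y) powr (1/4) < 1 powr (1/4)"
    using assms by (intro powr_less_mono2) auto
  moreover have "(b ^ 4 * y) powr (1/4) = b * y powr (1/4)"
    using assms by (simp add: powr_mult powr_powr flip: powr_numeral)
  ultimately show ?thesis
    using assms by (simp add: powr_minus divide_simps minus_divide_left[symmetric])
qed

text \<open>The Taylor coefficient of u^2 is 5/32. Rounding it up to 3/16 leaves room for the higher
  terms and is exactly what the gain in \<open>potential_gt\<close> can still pay for.\<close>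

lemma powr_quarter_quadratic_bound:
  fixes u :: real
  assumes "\<bar>u\<bar> \<le> 1 / 10"
  shows "(1 + u) powr (-1/4) \<le> 1 - u / 4 + 3 * u\<^sup>2 / 16"
proof -
  define w where "w = u / 4"
  have w: "\<bar>w\<bar> \<le> 1 / 40" and u: "u = 4 * w" using assms by (auto simp: w_def)
  have "(1 + 4 * w) powr (-1/4) \<le> 1 - w + 3 * w\<^sup>2"
  proof (rule powr_quarter_le)
    show "1 + 4 * w > 0" using w by (simp add: abs_le_iff)
    have "0 \<le> 3 * w\<^sup>2" by simp
    then show "1 - w + 3 * w\<^sup>2 > 0" using w unfolding abs_le_iff by linarith
    have pw: "\<bar>w ^ k\<bar> \<le> 1/1600" if "k \<ge> 2" for k
    proof -
      have "\<bar>w\<bar> ^ k \<le> \<bar>w\<bar> ^ 2" using that w by (intro power_decreasing) auto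
      also have "\<dots> \<le> (1 / 40) ^ 2" using w by (intro power_mono) auto
      finally show ?thesis by (simp add: power_abs power2_eq_square)
    qed
    \<comment> \<open>The linear term is at most 4/5 in absolute value. The other coefficients add
      up to 1846 in absolute value, so these terms contribute at most 1846/1600; the total stays
      below 2.\<close>
    have "0 \<le> 2 + 32 * w - 69 * w^2 + 244 * w^3 - 318 * w^4 + 540 * w^5 - 351 * w^6 + 324 * w^7"
      using w pw[of 2] pw[of 3] pw[of 4] pw[of 5] pw[of 6] pw[of 7]
      unfolding abs_le_iff by simp
    then have "0 \<le> w\<^sup>2 * (2 + 32 * w - 69 * w^2 + 244 * w^3 - 318 * w^4 + 540 * w^5 - 351 * w^6 + 324 * w^7)"
      by simp
    also have "\<dots> = (1 - w + 3 * w\<^sup>2) ^ 4 * (1 + 4 * w) - 1"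
      by algebra
    finally show "1 \<le> (1 - w + 3 * w\<^sup>2) ^ 4 * (1 + 4 * w)" by simp
  qed
  then show ?thesis by (simp add: u power_mult_distrib)
qed

text \<open>
  Any exponent below \<open>1/2\<close> gives a strictly superharmonic power of \<open>\<bar>x\<bar>\<^sup>2\<close> far from the origin; the
  shift by 99 makes the quadratic expansion valid at every lattice point.
\<close>

definition potential :: "int ^ 3 \<Rightarrow> real" where
  "potential x = (sq_norm x + 99) powr (-1/4)"

lemma potential_pos: "potential x > 0"
  using sq_norm_nonneg[of x] by (simp add: potential_def)

text \<open>A neighbour of x has squared norm |x|^2 + 1 + 2 x_i or |x|^2 + 1 - 2 x_i, so the
  expansion is around |x|^2 + 100; the linear terms of opposite neighbours cancel and the quadratic
  ones sum to a multiple of |x|^2.\<close>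

lemma nbr_avg_potential:
  "nbr_avg potential x \<le> (sq_norm x + 100) powr (-1/4) * (1 + sq_norm x / (4 * (sq_norm x + 100)\<^sup>2))"
proof -
  define s t where "s = sq_norm x" and "t = sq_norm x + 100"
  define u where "u = (\<lambda>i. 2 * real_of_int (x $ i) / t)"
  have s0: "s \<ge> 0" and t: "t = s + 100" and tpos: "t > 0"
    by (simp_all add: s_def t_def sq_norm_nonneg add_nonneg_pos)
  have u_small: "\<bar>u i\<bar> \<le> 1 / 10" for i
  proof -
    have "(real_of_int (x $ i))\<^sup>2 \<le> s"
      unfolding s_def sq_norm_def by (rule member_le_sum) auto
    \<comment> \<open>This is 400 s \<le> (s + 100)^2, which turns the shift into the bound 1/10
      required by the quadratic expansion.\<close>
    moreover have "0 \<le> (s - 100)\<^sup>2" by simp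
    ultimately have "(20 * real_of_int (x $ i))\<^sup>2 \<le> t\<^sup>2"
      unfolding t by (simp add: power2_eq_square algebra_simps)
    then have "\<bar>20 * real_of_int (x $ i)\<bar> \<le> t"
      using tpos abs_le_square_iff[of "20 * real_of_int (x $ i)" t] by simp
    with tpos show ?thesis by (simp add: u_def abs_mult divide_simps)
  qed
  have pot: "potential (x + axis i 1) = t powr (-1/4) * (1 + u i) powr (-1/4)"
    "potential (x + axis i (-1)) = t powr (-1/4) * (1 + - u i) powr (-1/4)" for i
  proof -
    have "t * (1 + u i) = sq_norm (x + axis i 1) + 99" "t * (1 + - u i) = sq_norm (x + axis i (-1)) + 99"
      using tpos by (simp_all add: u_def sq_norm_add_axis field_simps t s_def)
    moreover have "0 \<le> 1 + u i" "0 \<le> 1 + - u i" using u_small[of i] by auto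
    ultimately show "potential (x + axis i 1) = t powr (-1/4) * (1 + u i) powr (-1/4)"
      "potential (x + axis i (-1)) = t powr (-1/4) * (1 + - u i) powr (-1/4)"
      using tpos by (simp_all add: potential_def powr_mult[symmetric])
  qed
  have "nbr_avg potential x
      = t powr (-1/4) * (\<Sum>i\<in>UNIV. (1 + u i) powr (-1/4) + (1 + - u i) powr (-1/4)) / 6"
    unfolding nbr_avg_def sum_unit_steps pot by (simp only: sum_distrib_left distrib_left)
  also have "\<dots> \<le> t powr (-1/4) * (\<Sum>i\<in>UNIV. 2 + 3 * (u i)\<^sup>2 / 8) / 6"
  proof (intro divide_right_mono mult_left_mono sum_mono)
    fix i
    show "(1 + u i) powr (-1/4) + (1 + - u i) powr (-1/4) \<le> 2 + 3 * (u i)\<^sup>2 / 8"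
      using powr_quarter_quadratic_bound[of "u i"] powr_quarter_quadratic_bound[of "- u i"] u_small[of i]
      by simp
  qed auto
  also have "(\<Sum>i\<in>UNIV. 2 + 3 * (u i)\<^sup>2 / 8) = 6 + 3 / 8 * (\<Sum>i\<in>UNIV. (u i)\<^sup>2)"
    by (simp add: sum.distrib sum_distrib_left)
  also have "(\<Sum>i\<in>UNIV. (u i)\<^sup>2) = 4 * s / t\<^sup>2"
    by (simp add: u_def s_def sq_norm_def power_divide power_mult_distrib sum_divide_distrib sum_distrib_left)
  also have "t powr (-1/4) * (6 + 3 / 8 * (4 * s / t\<^sup>2)) / 6 = t powr (-1/4) * (1 + s / (4 * t\<^sup>2))"
    by (simp add: field_simps)
  finally show ?thesis unfolding s_def t_def .
qed

text \<open>The gain from having 99 instead of 100 in \<open>potential\<close>, by (1 - y)^(-1/4) >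
  1 + y/4 with y = 1/(|x|^2 + 100). It compensates the quadratic term of
  \<open>nbr_avg_potential\<close>.\<close>

lemma potential_gt:
  "(sq_norm x + 100) powr (-1/4) * (1 + 1 / (4 * (sq_norm x + 100))) < potential x"
proof -
  define t where "t = sq_norm x + 100"
  have t: "t \<ge> 100" using sq_norm_nonneg[of x] by (simp add: t_def)
  define y where "y = 1 / t"
  have y: "0 < y" "y \<le> 1/100" using t by (auto simp: y_def divide_simps)
  have "(1 + y / 4) ^ 4 * (1 - y) < 1"
  proof -
    define z where "z = y / 4"
    have z: "z > 0" "y = 4 * z" using y by (auto simp: z_def)
    have "(1 + z) ^ 4 * (1 - 4 * z) = 1 - (10 * z^2 + 20 * z^3 + 15 * z^4 + 4 * z^5)"
      by algebra
    moreover have "10 * z^2 + 20 * z^3 + 15 * z^4 + 4 * z^5 > 0"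
      using z by (intro add_pos_pos) auto
    ultimately show ?thesis unfolding z(2) by simp
  qed
  then have "1 + y / 4 < (1 - y) powr (-1/4)"
    using y by (intro powr_quarter_ge) auto
  then have "t powr (-1/4) * (1 + y / 4) < t powr (-1/4) * (1 - y) powr (-1/4)"
    using t by simp
  also have "\<dots> = (t * (1 - y)) powr (-1/4)"
    using t y by (simp add: powr_mult)
  also have "t * (1 - y) = sq_norm x + 99"
    using t by (simp add: y_def field_simps t_def)
  finally show ?thesis by (simp add: y_def t_def potential_def distrib_left mult.commute)
qed

lemma nbr_avg_potential_le: "nbr_avg potential x \<le> potential x"
proof -
  have "sq_norm x / (4 * (sq_norm x + 100)\<^sup>2) \<le> 1 / (4 * (sq_norm x + 100))"
  proof -
    define t where "t = sq_norm x + 100"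
    have t: "t > 0" "sq_norm x \<le> t" using sq_norm_nonneg[of x] by (auto simp: t_def)
    then have "sq_norm x / (4 * t\<^sup>2) \<le> t / (4 * t\<^sup>2)" by (intro divide_right_mono) auto
    also have "t / (4 * t\<^sup>2) = 1 / (4 * t)" using t by (simp add: power2_eq_square)
    finally show ?thesis by (simp only: t_def)
  qed
  then have "(sq_norm x + 100) powr (-1/4) * (1 + sq_norm x / (4 * (sq_norm x + 100)\<^sup>2))
      \<le> (sq_norm x + 100) powr (-1/4) * (1 + 1 / (4 * (sq_norm x + 100)))"
    by (intro mult_left_mono) auto
  then show ?thesis using nbr_avg_potential[of x] potential_gt[of x] by linarith
qed

lemma nbr_avg_potential_0: "nbr_avg potential 0 < potential 0"
proof -
  have "nbr_avg potential 0 \<le> 100 powr (-1/4)"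
    using nbr_avg_potential[of 0] by (simp add: sq_norm_def)
  also have "\<dots> < potential 0"
    by (simp add: potential_def sq_norm_def powr_less_mono2_neg)
  finally show ?thesis .
qed

text \<open>The multiple of \<open>potential\<close> by this constant drops by exactly 1 under
  averaging at the origin, which matches the unit source of the Green function.\<close>

definition green_const :: real where
  "green_const = 1 / (potential 0 - nbr_avg potential 0)"

text \<open>Comparison principle: the truncated sums are the iterates of f \<mapsto>
  \<open>indicator {0}\<close> + \<open>nbr_avg f\<close> started at 0, and
  \<open>green_const * potential\<close> is a supersolution of this recursion.\<close>

lemma sum_ret_prob_le: "(\<Sum>n<N. ret_prob n x) \<le> green_const * potential x"
proof (induction N arbitrary: x)
  case 0
  show ?case
    using nbr_avg_potential_0 potential_pos[of x] by (simp add: green_const_def)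
next
  case (Suc N)
  have "(\<Sum>n<Suc N. ret_prob n x) = indicator {0} x + nbr_avg (\<lambda>x. \<Sum>n<N. ret_prob n x) x"
    by (subst sum.lessThan_Suc_shift) (simp add: ret_prob_0 ret_prob_Suc nbr_avg_sum)
  also have "nbr_avg (\<lambda>x. \<Sum>n<N. ret_prob n x) x \<le> nbr_avg (\<lambda>x. green_const * potential x) x"
    by (rule nbr_avg_mono) (rule Suc)
  also have "\<dots> = green_const * nbr_avg potential x" by (simp add: nbr_avg_cmult)
  also have "indicator {0} x + green_const * nbr_avg potential x \<le> green_const * potential x"
  proof (cases "x = 0")
    case True
    then show ?thesis
      using nbr_avg_potential_0 by (simp add: green_const_def divide_simps)
  next
    case False
    then show ?thesis
      using nbr_avg_potential_0 nbr_avg_potential_le[of x]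
      by (simp add: green_const_def divide_right_mono)
  qed
  finally show ?case by simp
qed

lemma summable_ret_prob: "summable (\<lambda>n. ret_prob n x)"
  using sum_ret_prob_le by (intro summableI_nonneg_bounded ret_prob_nonneg)

lemma sum_ret_prob_le_green: "finite I \<Longrightarrow> (\<Sum>n\<in>I. ret_prob n x) \<le> green x"
  unfolding green_def by (intro sum_le_suminf summable_ret_prob ret_prob_nonneg) auto

lemma green_le: "green x \<le> green_const * potential x"
  unfolding green_def by (intro suminf_le_const summable_ret_prob sum_ret_prob_le)

lemma green_nonneg: "0 \<le> green x"
  unfolding green_def by (intro suminf_nonneg summable_ret_prob ret_prob_nonneg)

lemma green_uminus: "green (- x) = green x"
  by (simp add: green_def ret_prob_uminus)

lemma finite_green_gt:
  assumes "\<eta> > 0"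
  shows "finite {x. green x > \<eta>}"
proof -
  define c where "c = (green_const / \<eta>) ^ 4"
  have gc: "green_const > 0" using nbr_avg_potential_0 by (simp add: green_const_def)
  have "sq_norm x \<le> c" if "green x > \<eta>" for x
  proof -
    have "\<eta> / green_const < potential x"
      using that green_le[of x] gc by (simp add: divide_simps mult.commute)
    then have "\<not> 1 \<le> (\<eta> / green_const) ^ 4 * (sq_norm x + 99)"
      using powr_quarter_le[of "\<eta> / green_const" "sq_norm x + 99"] gc assms sq_norm_nonneg[of x]
      by (auto simp: potential_def)
    then have "(\<eta> / green_const) ^ 4 * (sq_norm x + 99) < 1" by simp
    then have "sq_norm x + 99 < c"
      using gc assms by (simp add: c_def field_simps)
    then show ?thesis by simp
  qed
  then have "{x. green x > \<eta>} \<subseteq> {x. sq_norm x \<le> c}" by blast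
  then show ?thesis by (rule finite_subset) (rule finite_sq_norm_le)
qed

section \<open>Dirichlet energy and cubes of the Green function\<close>

lemma finite_support_ret_prob: "finite {x. ret_prob n x \<noteq> 0}"
proof (induction n)
  case 0
  then show ?case by (simp add: ret_prob_0 indicator_def)
next
  case (Suc n)
  have "{x. ret_prob (Suc n) x \<noteq> 0} \<subseteq> (\<Union>e\<in>unit_steps. (\<lambda>x. x - e) ` {x. ret_prob n x \<noteq> 0})"
  proof
    fix x assume "x \<in> {x. ret_prob (Suc n) x \<noteq> 0}"
    then have "(\<Sum>e\<in>unit_steps. ret_prob n (x + e)) \<noteq> 0"
      by (simp add: ret_prob_Suc nbr_avg_def)
    then obtain e where "e \<in> unit_steps" "ret_prob n (x + e) \<noteq> 0"
      by (rule sum.not_neutral_contains_not_neutral)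
    moreover have "x = (x + e) - e" by simp
    ultimately show "x \<in> (\<Union>e\<in>unit_steps. (\<lambda>x. x - e) ` {x. ret_prob n x \<noteq> 0})" by blast
  qed
  with Suc show ?case by (meson finite_UN_I finite_imageI finite_subset finite_unit_steps)
qed

text \<open>Summation by parts. Over a finite set containing D and its shifts, both square terms
  have the same sum by translation invariance; 12 is this factor 2 times the 6 steps.\<close>

lemma dirichlet_energy_le:
  fixes g :: "int ^ 3 \<Rightarrow> real"
  assumes D: "finite D" "{x. g x \<noteq> 0} \<subseteq> D" and F: "finite F"
  shows "(\<Sum>e\<in>unit_steps. \<Sum>v\<in>F. (g (v + e) - g v)\<^sup>2) \<le> 12 * (\<Sum>v\<in>D. g v * (g v - nbr_avg g v))"
proof -
  define K where "K = F \<union> D \<union> (\<Union>e\<in>unit_steps. (\<lambda>v. v - e) ` D)"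
  have K: "finite K" "F \<subseteq> K" "D \<subseteq> K" using D(1) F by (auto simp: K_def)
  have out: "g v = 0" if "v \<notin> D" for v using that D(2) by blast
  have "(\<Sum>v\<in>F. (g (v + e) - g v)\<^sup>2) \<le> 2 * (\<Sum>v\<in>D. (g v)\<^sup>2) - 2 * (\<Sum>v\<in>D. g v * g (v + e))"
    if e: "e \<in> unit_steps" for e
  proof -
    have "(\<Sum>v\<in>F. (g (v + e) - g v)\<^sup>2) \<le> (\<Sum>v\<in>K. (g (v + e) - g v)\<^sup>2)"
      using K by (intro sum_mono2) auto
    also have "\<dots> = (\<Sum>v\<in>K. (g (v + e))\<^sup>2) + (\<Sum>v\<in>K. (g v)\<^sup>2) - 2 * (\<Sum>v\<in>K. g v * g (v + e))"
      by (simp add: power2_eq_square algebra_simps sum.distrib sum_subtractf sum_distrib_left)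
    also have "(\<Sum>v\<in>K. (g v)\<^sup>2) = (\<Sum>v\<in>D. (g v)\<^sup>2)"
      using K out by (intro sum.mono_neutral_right) auto
    also have "(\<Sum>v\<in>K. g v * g (v + e)) = (\<Sum>v\<in>D. g v * g (v + e))"
      using K out by (intro sum.mono_neutral_right) auto
    also have "(\<Sum>v\<in>K. (g (v + e))\<^sup>2) = (\<Sum>v\<in>(\<lambda>v. v - e) ` D. (g (v + e))\<^sup>2)"
    proof (rule sum.mono_neutral_right)
      show "(\<lambda>v. v - e) ` D \<subseteq> K" using e by (auto simp: K_def)
      show "\<forall>v\<in>K - (\<lambda>v. v - e) ` D. (g (v + e))\<^sup>2 = 0"
      proof
        fix v assume "v \<in> K - (\<lambda>v. v - e) ` D"
        then have "v + e \<notin> D" by (auto simp: image_iff)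
        then show "(g (v + e))\<^sup>2 = 0" by (simp add: out)
      qed
    qed (rule K(1))
    also have "\<dots> = (\<Sum>v\<in>D. (g v)\<^sup>2)"
      by (subst sum.reindex) (auto simp: inj_on_def)
    finally show ?thesis by simp
  qed
  then have "(\<Sum>e\<in>unit_steps. \<Sum>v\<in>F. (g (v + e) - g v)\<^sup>2)
      \<le> (\<Sum>e\<in>unit_steps. 2 * (\<Sum>v\<in>D. (g v)\<^sup>2) - 2 * (\<Sum>v\<in>D. g v * g (v + e)))"
    by (rule sum_mono)
  also have "\<dots> = 12 * (\<Sum>v\<in>D. (g v)\<^sup>2) - 2 * (\<Sum>v\<in>D. g v * (\<Sum>e\<in>unit_steps. g (v + e)))"
    by (simp add: sum_subtractf card_unit_steps sum_distrib_left sum.swap[of _ D])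
  also have "\<dots> = 12 * (\<Sum>v\<in>D. g v * (g v - nbr_avg g v))"
    by (simp add: nbr_avg_def power2_eq_square right_diff_distrib sum_subtractf sum_distrib_left mult_ac
        sum_divide_distrib)
  finally show ?thesis .
qed

lemma green_sums: "(\<lambda>N. \<Sum>n<N. ret_prob n x) \<longlonglongrightarrow> green x"
  unfolding green_def using summable_ret_prob by (rule summable_LIMSEQ)

text \<open>The truncation g to the first N terms has finite support, and g -
  \<open>nbr_avg g\<close> telescopes to the unit mass at 0 minus \<open>ret_prob N\<close>. Its
  energy is thus at most 12 g(0), uniformly in N, and the bound passes to the limit.\<close>

lemma green_step_energy:
  assumes "finite F" "e \<in> unit_steps"
  shows "(\<Sum>v\<in>F. (green (v + e) - green v)\<^sup>2) \<le> 12 * green 0"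
proof (rule LIMSEQ_le_const2)
  show "(\<lambda>N. \<Sum>v\<in>F. ((\<Sum>n<N. ret_prob n (v + e)) - (\<Sum>n<N. ret_prob n v))\<^sup>2)
      \<longlonglongrightarrow> (\<Sum>v\<in>F. (green (v + e) - green v)\<^sup>2)"
    by (intro tendsto_intros green_sums)
  show "\<exists>N. \<forall>n\<ge>N. (\<Sum>v\<in>F. ((\<Sum>n<n. ret_prob n (v + e)) - (\<Sum>n<n. ret_prob n v))\<^sup>2) \<le> 12 * green 0"
  proof (intro exI allI impI)
    fix N
    define g where "g = (\<lambda>x. \<Sum>n<N. ret_prob n x)"
    define D where "D = insert 0 (\<Union>n<N. {x. ret_prob n x \<noteq> 0})"
    have D: "finite D" "{x. g x \<noteq> 0} \<subseteq> D"
      using finite_support_ret_prob by (auto simp: D_def g_def dest: sum.not_neutral_contains_not_neutral)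
    have avg: "g v - nbr_avg g v = indicator {0} v - ret_prob N v" for v
    proof -
      have "nbr_avg g v = (\<Sum>n<N. ret_prob (Suc n) v)"
        by (simp add: g_def nbr_avg_sum ret_prob_Suc)
      then have "g v - nbr_avg g v = (\<Sum>n<N. ret_prob n v - ret_prob (Suc n) v)"
        by (simp add: g_def sum_subtractf)
      also have "\<dots> = ret_prob 0 v - ret_prob N v"
        by (rule sum_lessThan_telescope'[of "\<lambda>n. ret_prob n v"])
      finally show ?thesis by (simp add: ret_prob_0)
    qed
    have g0: "g v \<ge> 0" for v by (simp add: g_def sum_nonneg ret_prob_nonneg)
    have "(\<Sum>v\<in>F. (g (v + e) - g v)\<^sup>2) \<le> (\<Sum>e\<in>unit_steps. \<Sum>v\<in>F. (g (v + e) - g v)\<^sup>2)"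
      using assms by (intro member_le_sum[where f = "\<lambda>e. \<Sum>v\<in>F. (g (v + e) - g v)\<^sup>2"] sum_nonneg) auto
    also have "\<dots> \<le> 12 * (\<Sum>v\<in>D. g v * (g v - nbr_avg g v))"
      using D assms(1) by (rule dirichlet_energy_le)
    also have "(\<Sum>v\<in>D. g v * (g v - nbr_avg g v)) \<le> (\<Sum>v\<in>D. if v = 0 then g v else 0)"
      unfolding avg using g0 ret_prob_nonneg
      by (intro sum_mono) (auto simp: indicator_def algebra_simps)
    also have "\<dots> = g 0" using D(1) by (simp add: D_def)
    also have "\<dots> \<le> green 0" by (simp add: g_def sum_ret_prob_le_green)
    finally show "(\<Sum>v\<in>F. ((\<Sum>n<N. ret_prob n (v + e)) - (\<Sum>n<N. ret_prob n v))\<^sup>2) \<le> 12 * green 0"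
      by (simp add: g_def)
  qed
qed

definition finite_shift_energy :: "int ^ 3 \<Rightarrow> bool" where
  "finite_shift_energy a \<longleftrightarrow> (\<exists>K. \<forall>F. finite F \<longrightarrow> (\<Sum>v\<in>F. (green (v + a) - green v)\<^sup>2) \<le> K)"

lemma finite_shift_energy_0: "finite_shift_energy 0"
  by (auto simp: finite_shift_energy_def)

lemma finite_shift_energy_step: "e \<in> unit_steps \<Longrightarrow> finite_shift_energy e"
  unfolding finite_shift_energy_def by (intro exI[of _ "12 * green 0"]) (simp add: green_step_energy)

lemma finite_shift_energy_add:
  assumes "finite_shift_energy a" "finite_shift_energy b"
  shows "finite_shift_energy (a + b)"
proof -
  from assms obtain K L
    where K: "\<forall>F. finite F \<longrightarrow> (\<Sum>v\<in>F. (green (v + a) - green v)\<^sup>2) \<le> K"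
    and L: "\<forall>F. finite F \<longrightarrow> (\<Sum>v\<in>F. (green (v + b) - green v)\<^sup>2) \<le> L"
    unfolding finite_shift_energy_def by (elim exE)
  have "(\<Sum>v\<in>F. (green (v + (a + b)) - green v)\<^sup>2) \<le> 2 * K + 2 * L" if F: "finite F" for F
  proof -
    have sq: "(r + s)\<^sup>2 \<le> 2 * r\<^sup>2 + 2 * s\<^sup>2" for r s :: real
      using zero_le_power2[of "r - s"] by (simp add: power2_eq_square algebra_simps)
    have "(\<Sum>v\<in>F. (green (v + (a + b)) - green v)\<^sup>2)
        = (\<Sum>v\<in>F. ((green ((v + b) + a) - green (v + b)) + (green (v + b) - green v))\<^sup>2)"
      by (simp add: ac_simps)
    also have "\<dots> \<le> (\<Sum>v\<in>F. 2 * (green ((v + b) + a) - green (v + b))\<^sup>2 + 2 * (green (v + b) - green v)\<^sup>2)"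
      by (intro sum_mono sq)
    also have "\<dots> = 2 * (\<Sum>v\<in>F. (green ((v + b) + a) - green (v + b))\<^sup>2) + 2 * (\<Sum>v\<in>F. (green (v + b) - green v)\<^sup>2)"
      by (simp add: sum.distrib sum_distrib_left)
    also have "(\<Sum>v\<in>F. (green ((v + b) + a) - green (v + b))\<^sup>2)
        = (\<Sum>v\<in>(\<lambda>v. v + b) ` F. (green (v + a) - green v)\<^sup>2)"
      by (subst sum.reindex) (auto simp: inj_on_def)
    finally show ?thesis using K[rule_format, of "(\<lambda>v. v + b) ` F"] L[rule_format, OF F] F by simp
  qed
  then show ?thesis unfolding finite_shift_energy_def by (intro exI[of _ "2 * K + 2 * L"]) simp
qed

text \<open>Every lattice vector is a finite sum of unit steps, and each addition costs only a
  constant factor because (r + s)^2 \<le> 2 r^2 + 2 s^2.\<close>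

lemma finite_shift_energy: "finite_shift_energy a"
proof -
  have axis_add: "axis i (r + s) = axis i r + axis i s" for i :: 3 and r s :: int
    by (simp add: axis_def vec_eq_iff)
  have ax: "finite_shift_energy (axis i k)" for i k
  proof (induction k rule: int_induct[of _ 0])
    case base
    have "axis i 0 = (0 :: int ^ 3)" by (simp add: axis_def vec_eq_iff)
    with finite_shift_energy_0 show ?case by metis
  next
    case (step1 k)
    have "finite_shift_energy (axis i 1)"
      by (intro finite_shift_energy_step) (auto simp: unit_steps_def)
    then show ?case using finite_shift_energy_add[OF step1(2)] by (simp only: axis_add)
  next
    case (step2 k)
    have "finite_shift_energy (axis i (-1))"
      by (intro finite_shift_energy_step) (auto simp: unit_steps_def)
    then have "finite_shift_energy (axis i (k + - 1))"
      using finite_shift_energy_add[OF step2(2)] by (simp only: axis_add)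
    then show ?case by simp
  qed
  have "finite_shift_energy (\<Sum>i\<in>I. axis i (a $ i))" for I
    by (induction I rule: infinite_finite_induct)
      (auto intro: finite_shift_energy_0 finite_shift_energy_add ax)
  moreover have "(\<Sum>i\<in>UNIV. axis i (a $ i)) = a"
    by (simp add: vec_eq_iff axis_def)
  ultimately show ?thesis by metis
qed

section \<open>Divergence of the sum of cubes of the Green function\<close>

lemma power_mean_cube_le:
  fixes a :: "'a \<Rightarrow> real"
  assumes "\<And>i. i \<in> I \<Longrightarrow> a i \<ge> 0" "l \<ge> 0"
  shows "3 * l\<^sup>2 * (\<Sum>i\<in>I. a i) - 2 * l ^ 3 * real (card I) \<le> (\<Sum>i\<in>I. a i ^ 3)"
proof -
  have "3 * l\<^sup>2 * b - 2 * l ^ 3 \<le> b ^ 3" if "b \<ge> 0" for b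
  proof -
    \<comment> \<open>The cube lies above its tangent line at l. Choosing l as the mean value of the
      a i recovers the power mean inequality.\<close>
    have "0 \<le> (b - l)\<^sup>2 * (b + 2 * l)" using that assms by simp
    then show ?thesis by (simp add: power2_eq_square power3_eq_cube algebra_simps)
  qed
  then have "(\<Sum>i\<in>I. 3 * l\<^sup>2 * a i - 2 * l ^ 3) \<le> (\<Sum>i\<in>I. a i ^ 3)"
    using assms by (intro sum_mono) auto
  then show ?thesis by (simp add: sum_subtractf mult_ac flip: sum_distrib_left sum_distrib_right)
qed

lemma sum_cubes_le_cube_sum:
  fixes a :: "'a \<Rightarrow> real"
  assumes "\<And>i. i \<in> I \<Longrightarrow> a i \<ge> 0"
  shows "(\<Sum>i\<in>I. a i ^ 3) \<le> (\<Sum>i\<in>I. a i) ^ 3"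
  using assms
proof (induction I rule: infinite_finite_induct)
  case (insert i I)
  define s where "s = (\<Sum>i\<in>I. a i)"
  have "s \<ge> 0" "a i \<ge> 0" using insert by (auto simp: s_def sum_nonneg)
  then have "a i ^ 3 + s ^ 3 \<le> (a i + s) ^ 3"
    by (simp add: power3_eq_cube algebra_simps)
  with insert show ?case by (simp add: s_def)
qed auto

text \<open>Markov's inequality for |S_n|^2, whose mean is n: the indicator of the ball dominates 1
  - |x|^2 / R.\<close>

lemma ret_prob_ball_ge:
  assumes "R > 0"
  shows "(\<Sum>v | sq_norm v \<le> R. ret_prob n v) \<ge> 1 - real n / R"
proof -
  let ?F = "{v. sq_norm v \<le> R}"
  have "(\<Sum>v\<in>?F. ret_prob n v) = (nbr_avg ^^ n) (indicator ?F) 0"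
    using nbr_avg_pow_indicator[OF finite_sq_norm_le[of R], of n 0] by (simp add: ret_prob_uminus)
  also have "\<dots> \<ge> (nbr_avg ^^ n) (\<lambda>x. 1 + (- 1 / R) * sq_norm x) 0"
  proof (rule nbr_avg_pow_mono)
    fix x
    have "sq_norm x / R \<ge> 0" using assms by (simp add: sq_norm_nonneg)
    then show "1 + (- 1 / R) * sq_norm x \<le> indicator ?F x"
      using assms by (auto simp: indicator_def divide_simps)
  qed
  also have "(nbr_avg ^^ n) (\<lambda>x. 1 + (- 1 / R) * sq_norm x) = (\<lambda>x. 1 + (- 1 / R) * (nbr_avg ^^ n) sq_norm x)"
  proof (induction n)
    case (Suc n)
    show ?case
      by (simp only: funpow.simps o_apply Suc nbr_avg_add[of "\<lambda>_. 1"] nbr_avg_const nbr_avg_cmult)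
  qed simp
  finally show ?thesis by (simp add: nbr_avg_pow_sq_norm sq_norm_def)
qed

text \<open>During this window of 4^j times the walk is in the ball with probability at least 1/2. A
  mass of at least 4^j / 2 is spread over at most 125 * 8^j points, and by convexity its cubes have
  a sum bounded below independently of j.\<close>

lemma window_cube_sum_ge:
  "(\<Sum>v | sq_norm v \<le> 4 ^ Suc j. (\<Sum>n\<in>{4 ^ j..<2 * 4 ^ j}. ret_prob n v) ^ 3) \<ge> 1 / 125000"
proof -
  define F where "F = {v. sq_norm v \<le> 4 ^ Suc j}"
  define a where "a = (\<lambda>v. \<Sum>n\<in>{4 ^ j..<2 * 4 ^ j}. ret_prob n v)"
  have a: "a v \<ge> 0" for v by (simp add: a_def sum_nonneg ret_prob_nonneg)
  have "(4 :: real) ^ j * (1/2) = (\<Sum>n\<in>{4 ^ j..<2 * 4 ^ j :: nat}. 1/2)" by simp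
  also have "\<dots> \<le> (\<Sum>n\<in>{4 ^ j..<2 * 4 ^ j}. \<Sum>v\<in>F. ret_prob n v)"
  proof (rule sum_mono)
    fix n :: nat assume "n \<in> {4 ^ j..<2 * 4 ^ j}"
    then have "real n \<le> real (2 * 4 ^ j)" by (subst of_nat_le_iff) simp
    then have "1 / 2 \<le> 1 - real n / 4 ^ Suc j" by (simp add: field_simps)
    also have "\<dots> \<le> (\<Sum>v\<in>F. ret_prob n v)"
      unfolding F_def by (rule ret_prob_ball_ge) simp
    finally show "1 / 2 \<le> (\<Sum>v\<in>F. ret_prob n v)" .
  qed
  also have "\<dots> = (\<Sum>v\<in>F. a v)" unfolding a_def by (rule sum.swap)
  finally have mass: "4 ^ j / 2 \<le> (\<Sum>v\<in>F. a v)" by simp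
  have pc: "(c ^ m) ^ k = (c ^ k) ^ m" for c :: real and m k
    by (simp only: power_mult[symmetric] mult.commute)
  have "real ((2 ^ Suc j) ^ 2) = 4 ^ Suc j"
    using pc[of 2 "Suc j" 2] by simp
  then have "F \<subseteq> {x. \<forall>i. \<bar>x $ i\<bar> \<le> int (2 ^ Suc j)}"
    using ball_subset_box[of "2 ^ Suc j"] by (simp only: F_def)
  then have "card F \<le> (2 * 2 ^ Suc j + 1) ^ 3"
    using card_mono[OF finite_box] card_box by metis
  also have "\<dots> \<le> (5 * 2 ^ j) ^ 3"
    by (intro power_mono) auto
  finally have "real (card F) \<le> real ((5 * 2 ^ j) ^ 3)" by (rule of_nat_mono)
  also have "\<dots> = 125 * 8 ^ j"
    using pc[of 2 j 3] by (simp add: power_mult_distrib)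
  finally have cardF: "real (card F) \<le> 125 * 8 ^ j" .
  \<comment> \<open>The quotient of the mass 4^j / 2 by the number 125 * 8^j of available points,
    which is the optimal tangent point.\<close>
  define l where "l = (1 / 250 :: real) / 2 ^ j"
  have l2: "l\<^sup>2 * 4 ^ j = 1 / 62500" and l3: "l ^ 3 * 8 ^ j = 1 / 15625000"
    using pc[of 2 j 2] pc[of 2 j 3] by (simp_all add: l_def power_divide)
  have "1 / 125000 = 3 * (l\<^sup>2 * 4 ^ j) / 2 - 250 * (l ^ 3 * 8 ^ j)" unfolding l2 l3 by simp
  also have "\<dots> = 3 * l\<^sup>2 * (4 ^ j / 2) - 2 * l ^ 3 * (125 * 8 ^ j)" by simp
  also have "\<dots> \<le> 3 * l\<^sup>2 * (\<Sum>v\<in>F. a v) - 2 * l ^ 3 * real (card F)"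
    using mass cardF by (intro diff_mono mult_left_mono) (auto simp: l_def)
  also have "\<dots> \<le> (\<Sum>v\<in>F. a v ^ 3)"
    using a by (intro power_mean_cube_le) (auto simp: l_def)
  finally show ?thesis by (simp only: F_def a_def)
qed

text \<open>The time windows are disjoint, so \<open>green\<close> dominates the sum of their
  contributions. Cubes are superadditive on nonnegative numbers, so each scale adds a fixed
  amount.\<close>

lemma green_cube_sum_unbounded:
  obtains F where "finite F" "(\<Sum>v\<in>F. green v ^ 3) \<ge> C"
proof -
  obtain J :: nat where J: "C \<le> real J / 125000"
    using real_arch_simple[of "125000 * C"] by (auto simp: field_simps)
  define F where "F = {v. sq_norm v \<le> 4 ^ Suc J}"
  define a where "a = (\<lambda>j v. \<Sum>n\<in>{4 ^ j..<2 * 4 ^ j}. ret_prob n v)"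
  have a: "a j v \<ge> 0" for j v by (simp add: a_def sum_nonneg ret_prob_nonneg)
  have fin: "finite F" unfolding F_def by (rule finite_sq_norm_le)
  have disj: "disjoint_family (\<lambda>j. {4 ^ j..<2 * 4 ^ j :: nat})"
  proof -
    have "{4 ^ i..<2 * 4 ^ i :: nat} \<inter> {4 ^ j..<2 * 4 ^ j} = {}" if "i < j" for i j :: nat
    proof -
      have "(4 :: nat) ^ Suc i \<le> 4 ^ j" using that by (intro power_increasing) auto
      then show ?thesis by auto
    qed
    then show ?thesis unfolding disjoint_family_on_def by (metis Int_commute linorder_neqE_nat)
  qed
  have "real J / 125000 = (\<Sum>j<J. 1 / 125000)" by simp
  also have "\<dots> \<le> (\<Sum>j<J. \<Sum>v\<in>F. a j v ^ 3)"
  proof (rule sum_mono)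
    fix j assume "j \<in> {..<J}"
    then have "(4 :: real) ^ Suc j \<le> 4 ^ Suc J" by (intro power_increasing) auto
    then have "{v. sq_norm v \<le> 4 ^ Suc j} \<subseteq> F" unfolding F_def by (blast intro: order_trans)
    then have "(\<Sum>v | sq_norm v \<le> 4 ^ Suc j. a j v ^ 3) \<le> (\<Sum>v\<in>F. a j v ^ 3)"
      using fin a by (intro sum_mono2) auto
    with window_cube_sum_ge[of j] show "1 / 125000 \<le> (\<Sum>v\<in>F. a j v ^ 3)"
      unfolding a_def by linarith
  qed
  also have "\<dots> = (\<Sum>v\<in>F. \<Sum>j<J. a j v ^ 3)" by (rule sum.swap)
  also have "\<dots> \<le> (\<Sum>v\<in>F. green v ^ 3)"
  proof (rule sum_mono)
    fix v
    have "(\<Sum>j<J. a j v) = (\<Sum>n\<in>(\<Union>j<J. {4 ^ j..<2 * 4 ^ j}). ret_prob n v)"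
      unfolding a_def using disj by (subst sum.UNION_disjoint) (auto simp: disjoint_family_on_def)
    also have "\<dots> \<le> green v" by (intro sum_ret_prob_le_green) auto
    finally have "(\<Sum>j<J. a j v) \<le> green v" .
    then have "(\<Sum>j<J. a j v) ^ 3 \<le> green v ^ 3"
      using a by (intro power_mono sum_nonneg) auto
    with sum_cubes_le_cube_sum[of "{..<J}" "\<lambda>j. a j v"] a
    show "(\<Sum>j<J. a j v ^ 3) \<le> green v ^ 3" by simp
  qed
  finally show ?thesis using that[OF fin] J by linarith
qed

section \<open>A region for the second moment method\<close>

lemma green_le_const: "green x \<le> green_const"
proof -
  have "potential x \<le> 1"
    using sq_norm_nonneg[of x] powr_mono2'[of "-1/4" 1 "sq_norm x + 99"] by (simp add: potential_def)
  then have "green_const * potential x \<le> green_const * 1"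
    using nbr_avg_potential_0 by (intro mult_left_mono) (auto simp: green_const_def)
  with green_le[of x] show ?thesis by simp
qed

text \<open>At a bad v the values at v and v - a differ by at least half of \<open>green v\<close>.
  Two of the three factors of the cube are bounded by this difference, the third by
  \<open>green_const\<close>, and finite energy does the rest.\<close>

lemma green_cube_sum_bad_le:
  "\<exists>K. \<forall>F. finite F \<longrightarrow>
      (\<Sum>v\<in>F \<inter> {v. \<not> (green v / 2 < green (v - a) \<and> green (v - a) \<le> 2 * green v)}. green v ^ 3) \<le> K"
proof -
  obtain K where K: "\<forall>F. finite F \<longrightarrow> (\<Sum>v\<in>F. (green (v + - a) - green v)\<^sup>2) \<le> K"
    using finite_shift_energy[of "- a"] unfolding finite_shift_energy_def by (elim exE)
  have gc: "green_const \<ge> 0" using green_le_const[of 0] green_nonneg[of 0] by linarith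
  have "(\<Sum>v\<in>F \<inter> {v. \<not> (green v / 2 < green (v - a) \<and> green (v - a) \<le> 2 * green v)}. green v ^ 3)
      \<le> 4 * green_const * K" (is "sum _ ?B \<le> _") if F: "finite F" for F
  proof -
    have "(\<Sum>v\<in>?B. green v ^ 3) \<le> (\<Sum>v\<in>?B. 4 * green_const * (green (v + - a) - green v)\<^sup>2)"
    proof (rule sum_mono)
      fix v assume "v \<in> ?B"
      then have "green v / 2 \<le> \<bar>green (v + - a) - green v\<bar>"
        using green_nonneg[of v] by (auto simp: abs_if)
      then have "(green v / 2)\<^sup>2 \<le> (green (v + - a) - green v)\<^sup>2"
        using green_nonneg[of v] abs_le_square_iff[of "green v / 2"] by simp
      then have "(green v)\<^sup>2 \<le> 4 * (green (v + - a) - green v)\<^sup>2" by (simp add: power_divide)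
      then have "green v * (green v)\<^sup>2 \<le> green_const * (4 * (green (v + - a) - green v)\<^sup>2)"
        using green_le_const[of v] green_nonneg[of v] gc by (intro mult_mono) auto
      then show "green v ^ 3 \<le> 4 * green_const * (green (v + - a) - green v)\<^sup>2"
        by (simp add: power3_eq_cube power2_eq_square mult_ac)
    qed
    also have "\<dots> = 4 * green_const * (\<Sum>v\<in>?B. (green (v + - a) - green v)\<^sup>2)"
      by (simp only: sum_distrib_left)
    also have "\<dots> \<le> 4 * green_const * K"
      using K F gc by (intro mult_left_mono) auto
    finally show ?thesis .
  qed
  then show ?thesis by (intro exI[of _ "4 * green_const * K"]) simp
qed

text \<open>
  The points \<open>w\<close> of the level set with \<open>G(w - v) > G(w)\<close> are translated by \<open>-v\<close> into the level set.
\<close>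

lemma sum_green_cube_level_set:
  assumes "\<eta> > 0"
  defines "L \<equiv> {v. green v > \<eta>}"
  shows "(\<Sum>w\<in>L. green (w - v) ^ 3) \<le> 2 * (\<Sum>w\<in>L. green w ^ 3)"
proof -
  have L: "finite L" unfolding L_def using assms(1) by (rule finite_green_gt)
  have g3: "green x ^ 3 \<ge> 0" for x by (simp add: green_nonneg)
  have "(\<Sum>w\<in>L. green (w - v) ^ 3)
      = (\<Sum>w\<in>{w\<in>L. green (w - v) \<le> green w}. green (w - v) ^ 3)
        + (\<Sum>w\<in>{w\<in>L. green (w - v) > green w}. green (w - v) ^ 3)" (is "_ = sum _ ?A + sum _ ?B")
    using L by (subst sum.union_disjoint[symmetric]) (auto intro!: sum.cong)
  also have "(\<Sum>w\<in>?A. green (w - v) ^ 3) \<le> (\<Sum>w\<in>?A. green w ^ 3)"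
    by (intro sum_mono power_mono) (auto simp: green_nonneg)
  also have "\<dots> \<le> (\<Sum>w\<in>L. green w ^ 3)"
    using L g3 by (intro sum_mono2) auto
  also have "(\<Sum>w\<in>?B. green (w - v) ^ 3) = (\<Sum>u\<in>(\<lambda>w. w - v) ` ?B. green u ^ 3)"
    by (subst sum.reindex) (auto simp: inj_on_def)
  also have "\<dots> \<le> (\<Sum>w\<in>L. green w ^ 3)"
    using L g3 by (intro sum_mono2) (auto simp: L_def)
  finally show ?thesis by simp
qed

text \<open>Removing the bad points and B from a level set costs at most a constant C, while level
  sets carry arbitrarily large sums. One with sum at least 2 C + 1 keeps at least half of it, so the
  factor 2 of \<open>sum_green_cube_level_set\<close> becomes 4.\<close>

lemma obtain_good_region:
  assumes "finite A" "finite B"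
  obtains L N where "finite L" "L \<inter> B = {}" "(\<Sum>v\<in>L. green v ^ 3) > 0"
    "\<And>v. (\<Sum>w\<in>L. green (w - v) ^ 3) \<le> 4 * (\<Sum>w\<in>L. green w ^ 3)"
    "\<And>a v. a \<in> A \<Longrightarrow> v \<in> L \<Longrightarrow> green v / 2 \<le> (\<Sum>n<N. ret_prob n (v - a))"
    "\<And>a v. a \<in> A \<Longrightarrow> v \<in> L \<Longrightarrow> green (v - a) \<le> 2 * green v"
proof -
  define bad where "bad = (\<lambda>a. {v. \<not> (green v / 2 < green (v - a) \<and> green (v - a) \<le> 2 * green v)})"
  have g3: "green x ^ 3 \<ge> 0" for x by (simp add: green_nonneg)
  have "\<forall>a. \<exists>K. \<forall>F. finite F \<longrightarrow> (\<Sum>v\<in>F \<inter> bad a. green v ^ 3) \<le> K"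
    unfolding bad_def by (intro allI green_cube_sum_bad_le)
  from choice[OF this] obtain K
    where K: "\<And>a F. finite F \<Longrightarrow> (\<Sum>v\<in>F \<inter> bad a. green v ^ 3) \<le> K a" by auto
  define C where "C = (\<Sum>a\<in>A. K a) + (\<Sum>v\<in>B. green v ^ 3)"
  have C0: "C \<ge> 0"
    unfolding C_def using K[of "{}"] g3 by (intro add_nonneg_nonneg sum_nonneg) auto
  obtain F where F: "finite F" "(\<Sum>v\<in>F. green v ^ 3) \<ge> 2 * C + 1"
    by (rule green_cube_sum_unbounded)
  \<comment> \<open>Dropping zeros of \<open>green\<close> makes the minimum over F' positive; half
    of it is a strict level below all of F'.\<close>
  define F' where "F' = {v\<in>F. green v > 0}"
  have "(\<Sum>v\<in>F. green v ^ 3) = (\<Sum>v\<in>F'. green v ^ 3)"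
    unfolding F'_def using F(1)
    by (intro sum.mono_neutral_right) (auto simp: less_le green_nonneg)
  with F have F': "finite F'" "(\<Sum>v\<in>F'. green v ^ 3) \<ge> 2 * C + 1"
    by (auto simp: F'_def)
  with C0 have "F' \<noteq> {}" by auto
  define \<eta> where "\<eta> = Min (green ` F') / 2"
  have "\<eta> > 0" unfolding \<eta>_def using F'(1) \<open>F' \<noteq> {}\<close> by (auto simp: F'_def)
  have F'sub: "F' \<subseteq> {v. green v > \<eta>}"
  proof
    fix v assume v: "v \<in> F'"
    then have "Min (green ` F') \<le> green v" using F' by simp
    moreover have "green v > 0" using v by (simp add: F'_def)
    ultimately show "v \<in> {v. green v > \<eta>}" unfolding \<eta>_def by simp
  qed
  define H where "H = {v. green v > \<eta>}"
  define L where "L = H - (\<Union>a\<in>A. bad a) - B"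
  have H: "finite H" unfolding H_def using \<open>\<eta> > 0\<close> by (rule finite_green_gt)
  then have L: "finite L" by (simp add: L_def)
  have sH: "(\<Sum>v\<in>H. green v ^ 3) \<ge> 2 * C + 1"
    using F'(2) sum_mono2[OF H F'sub[folded H_def], of "\<lambda>v. green v ^ 3", OF g3] by linarith
  have "(\<Sum>v\<in>H. green v ^ 3) \<le> (\<Sum>v\<in>L. green v ^ 3) + (\<Sum>v\<in>(\<Union>a\<in>A. H \<inter> bad a) \<union> B. green v ^ 3)"
    using H L assms g3
    by (subst sum.union_disjoint[symmetric]) (auto intro!: sum_mono2 simp: L_def)
  also have "(\<Sum>v\<in>(\<Union>a\<in>A. H \<inter> bad a) \<union> B. green v ^ 3)
      \<le> (\<Sum>v\<in>(\<Union>a\<in>A. H \<inter> bad a). green v ^ 3) + (\<Sum>v\<in>B. green v ^ 3)"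
    using H assms g3 by (subst sum_Un) (auto intro!: sum_nonneg)
  also have "(\<Sum>v\<in>(\<Union>a\<in>A. H \<inter> bad a). green v ^ 3) \<le> (\<Sum>a\<in>A. \<Sum>v\<in>H \<inter> bad a. green v ^ 3)"
    using assms(1) H g3
  proof (induction A rule: finite_induct)
    case (insert a A)
    have "(\<Sum>v\<in>(\<Union>a\<in>insert a A. H \<inter> bad a). green v ^ 3)
        \<le> (\<Sum>v\<in>H \<inter> bad a. green v ^ 3) + (\<Sum>v\<in>(\<Union>a\<in>A. H \<inter> bad a). green v ^ 3)"
      using insert by (simp, subst sum_Un) (auto intro!: sum_nonneg)
    with insert show ?case by simp
  qed simp
  also have "\<dots> \<le> (\<Sum>a\<in>A. K a)" using K[OF H] by (rule sum_mono)
  finally have sL: "(\<Sum>v\<in>H. green v ^ 3) \<le> (\<Sum>v\<in>L. green v ^ 3) + C" by (simp add: C_def)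
  have dist: "(\<Sum>w\<in>L. green (w - v) ^ 3) \<le> 4 * (\<Sum>w\<in>L. green w ^ 3)" for v
  proof -
    have "(\<Sum>w\<in>L. green (w - v) ^ 3) \<le> (\<Sum>w\<in>H. green (w - v) ^ 3)"
      using H g3 by (intro sum_mono2) (auto simp: L_def)
    also have "\<dots> \<le> 2 * (\<Sum>w\<in>H. green w ^ 3)"
      unfolding H_def using \<open>\<eta> > 0\<close> by (rule sum_green_cube_level_set)
    finally show ?thesis using sL sH by linarith
  qed
  have "\<exists>N. \<forall>n\<ge>N. \<forall>v\<in>L. green v / 2 \<le> (\<Sum>n<n. ret_prob n (v - a))" if a: "a \<in> A" for a
  proof -
    have "\<forall>\<^sub>F n in sequentially. \<forall>v\<in>L. green v / 2 \<le> (\<Sum>n<n. ret_prob n (v - a))"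
    proof (intro eventually_ball_finite ballI L)
      fix v assume "v \<in> L"
      then have "green v / 2 < green (v - a)" using a by (auto simp: L_def bad_def)
      \<comment> \<open>The strict inequality demanded of good points leaves room for truncating the
        Green function at a finite time; since L is finite, one N serves all its points.\<close>
      then have "\<forall>\<^sub>F n in sequentially. green v / 2 < (\<Sum>n<n. ret_prob n (v - a))"
        using green_sums[of "v - a"] by (intro order_tendstoD)
      then show "\<forall>\<^sub>F n in sequentially. green v / 2 \<le> (\<Sum>n<n. ret_prob n (v - a))"
        by (rule eventually_mono) simp
    qed
    then show ?thesis by (simp add: eventually_sequentially)
  qed
  then have "\<forall>\<^sub>F n in sequentially. \<forall>a\<in>A. \<forall>v\<in>L. green v / 2 \<le> (\<Sum>n<n. ret_prob n (v - a))"
    using assms(1) by (intro eventually_ball_finite) (auto simp: eventually_sequentially)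
  then obtain N where N: "\<And>a v. a \<in> A \<Longrightarrow> v \<in> L \<Longrightarrow> green v / 2 \<le> (\<Sum>n<N. ret_prob n (v - a))"
    by (auto simp: eventually_sequentially)
  show ?thesis
  proof (rule that[of L N])
    show "L \<inter> B = {}" by (auto simp: L_def)
    show "(\<Sum>v\<in>L. green v ^ 3) > 0" using sL sH C0 by linarith
    show "green (v - a) \<le> 2 * green v" if "a \<in> A" "v \<in> L" for a v
      using that by (auto simp: L_def bad_def)
  qed (use L dist N in auto)
qed

lemma sum_power3_le:
  fixes x y :: real
  assumes "x \<ge> 0" "y \<ge> 0"
  shows "(x + y) ^ 3 \<le> 4 * (x ^ 3 + y ^ 3)"
proof -
  have "0 \<le> 3 * (x + y) * (x - y)\<^sup>2" using assms by simp
  then show ?thesis by (simp add: power3_eq_cube power2_eq_square algebra_simps)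
qed

text \<open>M bounds the expected number of visits of one walk to v and w, in either order. With the
  ratio bound the product of three is at most 8 (G(v) + G(w))^3 G(w - v)^3, where G is
  \<open>green\<close>; splitting the cube of the sum gives 32, symmetry in v and w a factor 2, and
  summing over one point a factor 4.\<close>

lemma double_green_sum_le:
  assumes L: "finite L"
    and dist: "\<And>v. (\<Sum>w\<in>L. green (w - v) ^ 3) \<le> 4 * (\<Sum>w\<in>L. green w ^ 3)"
    and ratio: "\<And>a v. a \<in> {a1, a2, a3} \<Longrightarrow> v \<in> L \<Longrightarrow> green (v - a) \<le> 2 * green v"
  defines "M \<equiv> \<lambda>a v w. green (v - a) * green (w - v) + green (w - a) * green (v - w)"
  shows "(\<Sum>v\<in>L. \<Sum>w\<in>L. M a1 v w * (M a2 v w * M a3 v w)) \<le> 256 * (\<Sum>v\<in>L. green v ^ 3)\<^sup>2"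
proof -
  define s where "s = (\<Sum>v\<in>L. green v ^ 3)"
  have sym: "green (v - w) = green (w - v)" for v w
    using green_uminus[of "w - v"] by simp
  have M0: "M a v w \<ge> 0" for a v w by (simp add: M_def green_nonneg)
  have M: "M a v w \<le> 2 * (green v + green w) * green (w - v)"
    if "a \<in> {a1, a2, a3}" "v \<in> L" "w \<in> L" for a v w
  proof -
    have "M a v w = (green (v - a) + green (w - a)) * green (w - v)"
      by (simp add: M_def sym[of v w] distrib_right)
    also have "\<dots> \<le> (2 * green v + 2 * green w) * green (w - v)"
      using that by (intro mult_right_mono add_mono ratio green_nonneg)
    finally show ?thesis by simp
  qed
  have "(\<Sum>v\<in>L. \<Sum>w\<in>L. M a1 v w * (M a2 v w * M a3 v w))
      \<le> (\<Sum>v\<in>L. \<Sum>w\<in>L. 32 * (green v ^ 3 * green (w - v) ^ 3 + green w ^ 3 * green (v - w) ^ 3))"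
  proof (intro sum_mono)
    fix v w assume vw: "v \<in> L" "w \<in> L"
    define b where "b = 2 * (green v + green w) * green (w - v)"
    have b0: "b \<ge> 0" by (simp add: b_def green_nonneg)
    have "M a v w \<le> b" if "a \<in> {a1, a2, a3}" for a
      unfolding b_def using that vw by (rule M)
    then have "M a1 v w * (M a2 v w * M a3 v w) \<le> b * (b * b)"
      using M0 b0 by (intro mult_mono mult_nonneg_nonneg) auto
    also have "\<dots> = 8 * (green v + green w) ^ 3 * green (w - v) ^ 3"
      unfolding b_def by algebra
    also have "\<dots> \<le> 8 * (4 * (green v ^ 3 + green w ^ 3)) * green (w - v) ^ 3"
      by (intro mult_right_mono mult_left_mono sum_power3_le) (auto simp: green_nonneg)
    finally show "M a1 v w * (M a2 v w * M a3 v w)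
        \<le> 32 * (green v ^ 3 * green (w - v) ^ 3 + green w ^ 3 * green (v - w) ^ 3)"
      by (simp add: sym[of v w] algebra_simps)
  qed
  also have "\<dots> = 32 * ((\<Sum>v\<in>L. \<Sum>w\<in>L. green v ^ 3 * green (w - v) ^ 3)
      + (\<Sum>v\<in>L. \<Sum>w\<in>L. green w ^ 3 * green (v - w) ^ 3))"
    by (simp only: sum_distrib_left[symmetric] sum.distrib)
  also have "(\<Sum>v\<in>L. \<Sum>w\<in>L. green w ^ 3 * green (v - w) ^ 3) = (\<Sum>v\<in>L. \<Sum>w\<in>L. green v ^ 3 * green (w - v) ^ 3)"
    by (rule sum.swap)
  also have "(\<Sum>v\<in>L. \<Sum>w\<in>L. green v ^ 3 * green (w - v) ^ 3) \<le> (\<Sum>v\<in>L. green v ^ 3 * (4 * s))"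
    unfolding sum_distrib_left[symmetric] s_def
    by (intro sum_mono mult_left_mono dist) (simp add: green_nonneg)
  also have "\<dots> = 4 * s\<^sup>2" by (simp add: s_def power2_eq_square flip: sum_distrib_right)
  finally show ?thesis by (simp add: s_def)
qed

text \<open>If the sum exceeds \<eta>, some summand exceeds \<eta> / \<open>card B\<close>, which
  confines v to finitely many translates of a level set. So B is hard to hit from all but finitely
  many points.\<close>

lemma finite_green_sum_gt:
  assumes "finite B" "\<eta> > 0"
  shows "finite {v. (\<Sum>b\<in>B. green (v - b)) > \<eta>}"
proof (cases "B = {}")
  case False
  then have c: "card B > 0" using assms by (simp add: card_gt_0_iff)
  have "{v. (\<Sum>b\<in>B. green (v - b)) > \<eta>} \<subseteq> (\<Union>b\<in>B. (\<lambda>u. u + b) ` {u. green u > \<eta> / card B})"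
  proof
    fix v assume v: "v \<in> {v. (\<Sum>b\<in>B. green (v - b)) > \<eta>}"
    have "\<exists>b\<in>B. green (v - b) > \<eta> / card B"
    proof (rule ccontr)
      assume "\<not> (\<exists>b\<in>B. green (v - b) > \<eta> / card B)"
      then have "(\<Sum>b\<in>B. green (v - b)) \<le> (\<Sum>b\<in>B. \<eta> / card B)" by (intro sum_mono) (simp add: not_less)
      with v c show False by simp
    qed
    then obtain b where "b \<in> B" "green (v - b) > \<eta> / card B" by blast
    moreover have "v = (v - b) + b" by simp
    ultimately show "v \<in> (\<Union>b\<in>B. (\<lambda>u. u + b) ` {u. green u > \<eta> / card B})" by blast
  qed
  moreover have "finite \<dots>"
    using assms c by (intro finite_UN_I finite_imageI finite_green_gt) auto
  ultimately show ?thesis by (rule finite_subset)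
qed (use assms in simp)

section \<open>The path space\<close>

abbreviation step_pmf :: "(int ^ 3) pmf" where
  "step_pmf \<equiv> pmf_of_set unit_steps"

abbreviation step_space :: "(nat \<Rightarrow> int ^ 3) measure" where
  "step_space \<equiv> \<Pi>\<^sub>M i\<in>UNIV. measure_pmf step_pmf"

definition walk :: "int ^ 3 \<Rightarrow> (nat \<Rightarrow> int ^ 3) \<Rightarrow> nat \<Rightarrow> int ^ 3" where
  "walk x s n = x + (\<Sum>i<n. s i)"

interpretation steps: sequence_space "measure_pmf step_pmf"
  by unfold_locales

interpretation step_pair: pair_prob_space step_space step_space
  by unfold_locales

lemma space_step_space [simp]: "space step_space = UNIV"
  by (simp add: space_PiM PiE_def)

lemma walk_0 [simp]: "walk x s 0 = x"
  by (simp add: walk_def)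

lemma walk_Suc: "walk x s (Suc n) = walk x s n + s n"
  by (simp add: walk_def add.assoc)

lemma walk_case_nat: "walk x (case_nat e s) (Suc n) = walk (x + e) s n"
  by (simp add: walk_def sum.lessThan_Suc_shift add.assoc del: sum.lessThan_Suc)

section \<open>The Markov property at a fixed time and visiting probabilities\<close>

lemma walk_comb_seq_le: "n \<le> m \<Longrightarrow> walk x (comb_seq m s t) n = walk x s n"
  by (auto simp: walk_def comb_seq_def intro!: sum.cong)

text \<open>The pathwise half of the Markov property: after the gluing time the walk restarts at its
  current position with the steps t.\<close>

lemma walk_comb_seq_add: "walk x (comb_seq m s t) (m + j) = walk (walk x s m) t j"
proof (induction j)
  case (Suc j)
  have "comb_seq m s t (m + j) = t j" by (simp add: comb_seq_def)
  with Suc show ?case by (simp add: walk_Suc)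
qed (simp add: walk_comb_seq_le)

lemma measurable_step [measurable]: "(\<lambda>s. s i) \<in> step_space \<rightarrow>\<^sub>M count_space UNIV"
proof -
  have "(\<lambda>s. s i) \<in> step_space \<rightarrow>\<^sub>M measure_pmf step_pmf" by measurable
  then show ?thesis by simp
qed

lemma measurable_walk [measurable]: "(\<lambda>s. walk x s n) \<in> step_space \<rightarrow>\<^sub>M count_space UNIV"
proof (induction n)
  case (Suc n)
  have "(\<lambda>s. a + s n) \<in> step_space \<rightarrow>\<^sub>M count_space UNIV" for a
    by (rule measurable_compose[OF measurable_step]) simp
  from measurable_compose_countable[OF this Suc] show ?case by (simp add: walk_Suc)
qed simp

lemma sets_step_spaceI: "Measurable.pred step_space P \<Longrightarrow> {s. P s} \<in> sets step_space"
  by (simp add: pred_def)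

lemma sets_walk_eq [measurable]:
  "{s. walk x s n = v} \<in> sets step_space"
  "{s. walk x s m = v \<and> walk x s n = w} \<in> sets step_space"
  "{s. walk x s n \<in> B} \<in> sets step_space"
  by (intro sets_step_spaceI; measurable)+

text \<open>The distributional half of the Markov property: replacing all steps from time m on by an
  independent copy preserves the law.\<close>

lemma nn_integral_step_space_comb_seq:
  assumes [measurable]: "f \<in> borel_measurable step_space"
  shows "(\<integral>\<^sup>+s. f s \<partial>step_space) = (\<integral>\<^sup>+s. (\<integral>\<^sup>+t. f (comb_seq m s t) \<partial>step_space) \<partial>step_space)"
proof -
  have "(\<integral>\<^sup>+s. f s \<partial>step_space)
      = (\<integral>\<^sup>+s. f s \<partial>distr (step_space \<Otimes>\<^sub>M step_space) step_space (\<lambda>(\<omega>, \<omega>'). comb_seq m \<omega> \<omega>'))"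
    by (simp only: steps.PiM_comb_seq)
  also have "\<dots> = (\<integral>\<^sup>+p. f (case p of (\<omega>, \<omega>') \<Rightarrow> comb_seq m \<omega> \<omega>') \<partial>(step_space \<Otimes>\<^sub>M step_space))"
    by (rule nn_integral_distr) measurable
  also have "\<dots> = (\<integral>\<^sup>+s. (\<integral>\<^sup>+t. f (comb_seq m s t) \<partial>step_space) \<partial>step_space)"
    by (subst steps.P.nn_integral_fst[symmetric]) auto
  finally show ?thesis .
qed

lemma nn_integral_step_space_iter:
  assumes [measurable]: "f \<in> borel_measurable step_space"
  shows "(\<integral>\<^sup>+s. f s \<partial>step_space) = (\<integral>\<^sup>+e. (\<integral>\<^sup>+s. f (case_nat e s) \<partial>step_space) \<partial>measure_pmf step_pmf)"
proof -
  have "(\<integral>\<^sup>+s. f s \<partial>step_space)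
      = (\<integral>\<^sup>+s. f s \<partial>distr (measure_pmf step_pmf \<Otimes>\<^sub>M step_space) step_space (\<lambda>(e, \<omega>). case_nat e \<omega>))"
    by (simp only: steps.PiM_iter)
  also have "\<dots> = (\<integral>\<^sup>+p. f (case p of (e, \<omega>) \<Rightarrow> case_nat e \<omega>) \<partial>(measure_pmf step_pmf \<Otimes>\<^sub>M step_space))"
    by (rule nn_integral_distr) measurable
  also have "\<dots> = (\<integral>\<^sup>+e. (\<integral>\<^sup>+s. f (case_nat e s) \<partial>step_space) \<partial>measure_pmf step_pmf)"
    by (subst steps.P.nn_integral_fst[symmetric]) auto
  finally show ?thesis .
qed

text \<open>Decomposition at the first step, in line with the recursion of \<open>ret_prob\<close>;
  the symmetry of the step set absorbs the sign of the step.\<close>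

lemma emeasure_walk_eq: "emeasure step_space {s. walk x s n = v} = ennreal (ret_prob n (v - x))"
proof (induction n arbitrary: x)
  case 0
  have "{s. walk x s 0 = v} = (if x = v then UNIV else {})" by auto
  then show ?case
    using steps.P.emeasure_space_1 by (simp add: ret_prob_0 indicator_def)
next
  case (Suc n)
  have "emeasure step_space {s. walk x s (Suc n) = v}
      = (\<integral>\<^sup>+s. indicator {s. walk x s (Suc n) = v} s \<partial>step_space)"
    by (rule nn_integral_indicator[symmetric]) measurable
  also have "\<dots> = (\<integral>\<^sup>+e. (\<integral>\<^sup>+s. indicator {s. walk x s (Suc n) = v} (case_nat e s) \<partial>step_space) \<partial>measure_pmf step_pmf)"
    by (rule nn_integral_step_space_iter) measurable
  also have "\<dots> = (\<integral>\<^sup>+e. (\<integral>\<^sup>+s. indicator {s. walk (x + e) s n = v} s \<partial>step_space) \<partial>measure_pmf step_pmf)"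
    by (intro nn_integral_cong) (simp add: indicator_def walk_case_nat)
  also have "\<dots> = (\<integral>\<^sup>+e. emeasure step_space {s. walk (x + e) s n = v} \<partial>measure_pmf step_pmf)"
    by (intro nn_integral_cong nn_integral_indicator) measurable
  also have "\<dots> = (\<integral>\<^sup>+e. ennreal (ret_prob n (v - (x + e))) \<partial>measure_pmf step_pmf)"
    by (simp only: Suc)
  also have "\<dots> = (\<Sum>e\<in>unit_steps. ennreal (ret_prob n (v - (x + e)))) / of_nat (card unit_steps)"
    by (rule nn_integral_pmf_of_set) auto
  also have "\<dots> = ennreal ((\<Sum>e\<in>unit_steps. ret_prob n ((v - x) + - e)) / 6)"
    by (simp add: card_unit_steps sum_ennreal ret_prob_nonneg sum_nonneg divide_ennreal diff_diff_eq
        flip: ennreal_numeral)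
  also have "(\<Sum>e\<in>unit_steps. ret_prob n ((v - x) + - e)) = (\<Sum>e\<in>unit_steps. ret_prob n ((v - x) + e))"
    by (rule sum_unit_steps_uminus)
  finally show ?case by (simp add: ret_prob_Suc nbr_avg_def)
qed

lemma prob_walk_eq: "measure step_space {s. walk x s n = v} = ret_prob n (v - x)"
  by (simp add: measure_def emeasure_walk_eq ret_prob_nonneg)

lemma prob_walk_eq_eq:
  "measure step_space {s. walk x s m = v \<and> walk x s (m + j) = w} = ret_prob m (v - x) * ret_prob j (w - v)"
proof -
  have "emeasure step_space {s. walk x s m = v \<and> walk x s (m + j) = w}
      = (\<integral>\<^sup>+s. indicator {s. walk x s m = v \<and> walk x s (m + j) = w} s \<partial>step_space)"
    by (rule nn_integral_indicator[symmetric]) measurable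
  also have "\<dots> = (\<integral>\<^sup>+s. (\<integral>\<^sup>+t. indicator {s. walk x s m = v \<and> walk x s (m + j) = w} (comb_seq m s t) \<partial>step_space) \<partial>step_space)"
    by (rule nn_integral_step_space_comb_seq) measurable
  also have "\<dots> = (\<integral>\<^sup>+s. (\<integral>\<^sup>+t. indicator {s. walk x s m = v} s * indicator {t. walk v t j = w} t \<partial>step_space) \<partial>step_space)"
    by (intro nn_integral_cong) (auto simp: indicator_def walk_comb_seq_le walk_comb_seq_add)
  also have "\<dots> = (\<integral>\<^sup>+s. indicator {s. walk x s m = v} s * ennreal (ret_prob j (w - v)) \<partial>step_space)"
    by (simp add: nn_integral_cmult emeasure_walk_eq)
  also have "\<dots> = ennreal (ret_prob m (v - x)) * ennreal (ret_prob j (w - v))"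
    by (simp add: nn_integral_multc emeasure_walk_eq)
  finally show ?thesis
    by (simp add: measure_def ret_prob_nonneg flip: ennreal_mult)
qed

text \<open>Split by which of the two times comes first. By the Markov property each order factors
  into a time and a waiting time, and both sums extend to Green functions; counting equal times
  twice only weakens the bound.\<close>

lemma sum_prob_walk_pair_le:
  "(\<Sum>m<N. \<Sum>m'<N. measure step_space {s. walk x s m = v \<and> walk x s m' = w})
    \<le> green (v - x) * green (w - v) + green (w - x) * green (v - w)"
proof -
  have half: "(\<Sum>m<N. \<Sum>j<N. ret_prob m (v - x) * ret_prob j (w - v)) \<le> green (v - x) * green (w - v)" for v w
    unfolding sum_product[symmetric]
    by (intro mult_mono sum_ret_prob_le_green green_nonneg sum_nonneg ret_prob_nonneg) auto
  have "measure step_space {s. walk x s m = v \<and> walk x s m' = w}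
      \<le> (if m \<le> m' then ret_prob m (v - x) * ret_prob (m' - m) (w - v) else 0)
        + (if m' \<le> m then ret_prob m' (w - x) * ret_prob (m - m') (v - w) else 0)" for m m'
    using prob_walk_eq_eq[of x m v "m' - m" w] prob_walk_eq_eq[of x m' w "m - m'" v]
    by (auto simp: ret_prob_nonneg conj_commute not_le)
  then have "(\<Sum>m<N. \<Sum>m'<N. measure step_space {s. walk x s m = v \<and> walk x s m' = w})
      \<le> (\<Sum>m<N. \<Sum>m'<N. (if m \<le> m' then ret_prob m (v - x) * ret_prob (m' - m) (w - v) else 0)
        + (if m' \<le> m then ret_prob m' (w - x) * ret_prob (m - m') (v - w) else 0))"
    by (intro sum_mono)
  also have "\<dots> = (\<Sum>m<N. \<Sum>m'<N. if m \<le> m' then ret_prob m (v - x) * ret_prob (m' - m) (w - v) else 0)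
      + (\<Sum>m<N. \<Sum>m'<N. if m \<le> m' then ret_prob m (w - x) * ret_prob (m' - m) (v - w) else 0)"
    unfolding sum.distrib by (intro arg_cong2[where f = "(+)"] refl sum.swap)
  finally have split: "(\<Sum>m<N. \<Sum>m'<N. measure step_space {s. walk x s m = v \<and> walk x s m' = w})
      \<le> (\<Sum>m<N. \<Sum>m'<N. if m \<le> m' then ret_prob m (v - x) * ret_prob (m' - m) (w - v) else 0)
        + (\<Sum>m<N. \<Sum>m'<N. if m \<le> m' then ret_prob m (w - x) * ret_prob (m' - m) (v - w) else 0)" .
  have "(\<Sum>m<N. \<Sum>m'<N. if m \<le> m' then ret_prob m (v - x) * ret_prob (m' - m) (w - v) else 0)
      \<le> green (v - x) * green (w - v)" for v w
  proof -
    have "(\<Sum>m'<N. if m \<le> m' then ret_prob m (v - x) * ret_prob (m' - m) (w - v) else 0)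
        \<le> (\<Sum>j<N. ret_prob m (v - x) * ret_prob j (w - v))" for m
    proof -
      have "(\<Sum>m'<N. if m \<le> m' then ret_prob m (v - x) * ret_prob (m' - m) (w - v) else 0)
          = (\<Sum>m'\<in>{m..<N}. ret_prob m (v - x) * ret_prob (m' - m) (w - v))"
        by (intro sum.mono_neutral_cong_right) auto
      also have "\<dots> = (\<Sum>j\<in>(\<lambda>m'. m' - m) ` {m..<N}. ret_prob m (v - x) * ret_prob j (w - v))"
        by (subst sum.reindex) (auto simp: inj_on_def)
      also have "\<dots> \<le> (\<Sum>j<N. ret_prob m (v - x) * ret_prob j (w - v))"
        by (intro sum_mono2) (auto simp: ret_prob_nonneg)
      finally show ?thesis .
    qed
    then have "(\<Sum>m<N. \<Sum>m'<N. if m \<le> m' then ret_prob m (v - x) * ret_prob (m' - m) (w - v) else 0)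
        \<le> (\<Sum>m<N. \<Sum>j<N. ret_prob m (v - x) * ret_prob j (w - v))" by (rule sum_mono)
    with half[of v w] show ?thesis by linarith
  qed
  from this[of v w] this[of w v] split show ?thesis by linarith
qed

text \<open>A union bound over all times and all points of B.\<close>

lemma prob_walk_hits_le:
  assumes "finite B"
  shows "measure step_space {t. \<exists>j. walk v t j \<in> B} \<le> (\<Sum>b\<in>B. green (v - b))"
proof -
  have sums: "(\<lambda>j. \<Sum>b\<in>B. ret_prob j (v - b)) sums (\<Sum>b\<in>B. green (v - b))"
    unfolding green_def by (intro sums_sum summable_sums summable_ret_prob)
  have "ret_prob j (b - v) = ret_prob j (v - b)" for j b
    using ret_prob_uminus[of j "v - b"] by simp
  then have le: "measure step_space {t. walk v t j \<in> B} \<le> (\<Sum>b\<in>B. ret_prob j (v - b))" for j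
  proof -
    have "{t. walk v t j \<in> B} = (\<Union>b\<in>B. {t. walk v t j = b})" by auto
    also have "measure step_space \<dots> \<le> (\<Sum>b\<in>B. measure step_space {t. walk v t j = b})"
      using assms by (intro steps.P.finite_measure_subadditive_finite) auto
    finally show ?thesis
      using \<open>\<And>j b. ret_prob j (b - v) = ret_prob j (v - b)\<close> by (simp add: prob_walk_eq)
  qed
  have summ: "summable (\<lambda>j. measure step_space {t. walk v t j \<in> B})"
    by (rule summable_comparison_test'[OF sums_summable[OF sums]]) (simp add: le)
  have "measure step_space (\<Union>j. {t. walk v t j \<in> B}) \<le> (\<Sum>j. measure step_space {t. walk v t j \<in> B})"
    by (rule steps.P.finite_measure_subadditive_countably) (auto simp: summ)
  also have "\<dots> \<le> (\<Sum>j. \<Sum>b\<in>B. ret_prob j (v - b))"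
    by (intro suminf_le le summ sums_summable[OF sums])
  also have "\<dots> = (\<Sum>b\<in>B. green (v - b))" by (rule sums_unique[OF sums, symmetric])
  also have "(\<Union>j. {t. walk v t j \<in> B}) = {t. \<exists>j. walk v t j \<in> B}" by auto
  finally show ?thesis .
qed

text \<open>Exchanging the coordinates preserves the measure and swaps the two possible comparisons,
  which together cover the whole space.\<close>

lemma prob_iid_le_ge_half:
  fixes f :: "(nat \<Rightarrow> int ^ 3) \<Rightarrow> nat"
  assumes [measurable]: "f \<in> step_space \<rightarrow>\<^sub>M count_space UNIV"
  shows "measure (step_space \<Otimes>\<^sub>M step_space) {p. f (snd p) \<le> f (fst p)} \<ge> 1 / 2"
proof -
  let ?P = "step_space \<Otimes>\<^sub>M step_space"
  have [measurable]: "(\<lambda>p. f (fst p)) \<in> ?P \<rightarrow>\<^sub>M count_space UNIV" "(\<lambda>p. f (snd p)) \<in> ?P \<rightarrow>\<^sub>M count_space UNIV"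
    by (rule measurable_compose[OF measurable_fst assms] measurable_compose[OF measurable_snd assms])+
  have "Measurable.pred ?P (\<lambda>p. \<exists>i j. i \<le> j \<and> f (snd p) = i \<and> f (fst p) = j)"
    "Measurable.pred ?P (\<lambda>p. \<exists>i j. i \<le> j \<and> f (fst p) = i \<and> f (snd p) = j)"
    by measurable
  then have pred: "Measurable.pred ?P (\<lambda>p. f (snd p) \<le> f (fst p))"
    "Measurable.pred ?P (\<lambda>p. f (fst p) \<le> f (snd p))"
    by simp_all
  have sp: "space ?P = UNIV" by (simp add: space_pair_measure)
  have meas: "{p. f (snd p) \<le> f (fst p)} \<in> sets ?P" "{p. f (fst p) \<le> f (snd p)} \<in> sets ?P"
    using pred sp by (simp_all add: pred_def)
  have "measure ?P {p. f (fst p) \<le> f (snd p)}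
      = measure (distr ?P ?P (\<lambda>(x, y). (y, x))) {p. f (fst p) \<le> f (snd p)}"
    using step_pair.distr_pair_swap by simp
  also have "\<dots> = measure ?P {p. f (snd p) \<le> f (fst p)}"
    using meas sp by (subst measure_distr) (auto simp: vimage_def case_prod_beta)
  finally have eq: "measure ?P {p. f (fst p) \<le> f (snd p)} = measure ?P {p. f (snd p) \<le> f (fst p)}" .
  have "1 = measure ?P ({p. f (snd p) \<le> f (fst p)} \<union> {p. f (fst p) \<le> f (snd p)})"
    using step_pair.prob_space sp by (simp add: Un_def linear)
  also have "\<dots> \<le> measure ?P {p. f (snd p) \<le> f (fst p)} + measure ?P {p. f (fst p) \<le> f (snd p)}"
    using meas by (rule measure_Un_le)
  finally show ?thesis using eq by simp
qed

section \<open>Erased paths\<close>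

text \<open>Membership in the limit path without a description operator; only countable quantifiers
  over discrete data occur, which makes it measurable.\<close>

definition kept :: "'a set \<Rightarrow> (nat \<Rightarrow> 'a) \<Rightarrow> 'a \<Rightarrow> bool" where
  "kept A x v \<longleftrightarrow> (\<exists>k m. \<forall>n\<ge>m. k < length (erased_path A x n) \<and> erased_path A x n ! k = v)"

definition triple_hit :: "'a set \<Rightarrow> (nat \<Rightarrow> 'a) \<Rightarrow> (nat \<Rightarrow> 'a) \<Rightarrow> (nat \<Rightarrow> 'a) \<Rightarrow> bool" where
  "triple_hit B x y z \<longleftrightarrow> (\<exists>v. v \<notin> B \<and> v \<in> range z \<and> v \<in> range y \<and> kept (range z) x v)"

lemma kept_in_range:
  assumes "kept A x v"
  shows "v \<in> range (partial_loop_erasure A x)"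
proof -
  from assms obtain k m where km: "\<And>n. n \<ge> m \<Longrightarrow> k < length (erased_path A x n) \<and> erased_path A x n ! k = v"
    unfolding kept_def by blast
  have "partial_loop_erasure A x k = v"
    unfolding partial_loop_erasure_def
  proof (rule the_equality)
    show "\<forall>\<^sub>F m in sequentially. k < length (erased_path A x m) \<and> erased_path A x m ! k = v"
      using km unfolding eventually_sequentially by blast
    fix u assume "\<forall>\<^sub>F m in sequentially. k < length (erased_path A x m) \<and> erased_path A x m ! k = u"
    then obtain m' where "\<And>n. n \<ge> m' \<Longrightarrow> erased_path A x n ! k = u"
      unfolding eventually_sequentially by blast
    from this[of "max m m'"] km[of "max m m'"] show "u = v" by simp
  qed
  then show ?thesis by (metis rangeI)
qed

lemma erased_path_last: "erased_path A x m \<noteq> [] \<and> last (erased_path A x m) = x m"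
proof (cases m)
  case (Suc n)
  define w where "w = erased_path A x n"
  show ?thesis
  proof (cases "x m \<in> A \<and> x m \<in> set w")
    case True
    define i where "i = (LEAST i. i < length w \<and> w ! i = x m)"
    have "\<exists>i. i < length w \<and> w ! i = x m" using True by (simp add: in_set_conv_nth)
    then have i: "i < length w" "w ! i = x m" unfolding i_def by (metis (mono_tags, lifting) LeastI_ex)+
    have "erased_path A x m = take (Suc i) w" using True Suc by (simp add: w_def i_def Let_def)
    with i show ?thesis by (simp add: take_Suc_conv_app_nth)
  next
    case False
    then have "erased_path A x m = w @ [x m]" using Suc by (auto simp: w_def Let_def)
    then show ?thesis by simp
  qed
qed simp

lemma erased_path_cong:
  "(\<And>i. i \<le> m \<Longrightarrow> x i = y i) \<Longrightarrow> erased_path A x m = erased_path A y m"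
proof (induction m)
  case (Suc m)
  then have "erased_path A x m = erased_path A y m" "x (Suc m) = y (Suc m)" by auto
  then show ?case by simp
qed simp

text \<open>Entry k can vanish only when the path is cut at an earlier entry, and cuts happen only
  at vertices of A. If no such entry is revisited, the first k + 1 entries are frozen.\<close>

lemma kept_if_never_hit_before:
  assumes k: "k < length (erased_path A x m)"
    and never: "\<And>j t. j < k \<Longrightarrow> erased_path A x m ! j \<in> A \<Longrightarrow> x (m + t) \<noteq> erased_path A x m ! j"
  shows "kept A x (erased_path A x m ! k)"
proof -
  define w where "w = erased_path A x m"
  have "k < length (erased_path A x (m + t)) \<and> take (Suc k) (erased_path A x (m + t)) = take (Suc k) w" for t
  proof (induction t)
    case 0
    then show ?case using k by (simp add: w_def)
  next
    case (Suc t)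
    define u v where "u = erased_path A x (m + t)" and "v = x (m + Suc t)"
    have u: "k < length u" "take (Suc k) u = take (Suc k) w" using Suc by (auto simp: u_def)
    have step: "erased_path A x (m + Suc t) =
      (if v \<in> A \<and> v \<in> set u then take (Suc (LEAST i. i < length u \<and> u ! i = v)) u else u @ [v])"
      by (simp add: u_def v_def Let_def)
    show ?case
    proof (cases "v \<in> A \<and> v \<in> set u")
      case True
      define i where "i = (LEAST i. i < length u \<and> u ! i = v)"
      have "\<exists>i. i < length u \<and> u ! i = v" using True by (simp add: in_set_conv_nth)
      then have i: "i < length u" "u ! i = v" unfolding i_def by (metis (mono_tags, lifting) LeastI_ex)+
      \<comment> \<open>Equality is harmless: a cut at index k keeps entry k itself.\<close>
      have "k \<le> i"
      proof (rule ccontr)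
        assume "\<not> k \<le> i"
        then have "w ! i = u ! i" using u(2) by (metis nth_take less_Suc_eq not_le)
        with never[of i "Suc t"] True i \<open>\<not> k \<le> i\<close> show False by (simp add: w_def v_def)
      qed
      with True u i show ?thesis unfolding step by (simp add: i_def[symmetric] min_def)
    next
      case False
      with u show ?thesis unfolding step by auto
    qed
  qed
  then have *: "k < length (erased_path A x n) \<and> erased_path A x n ! k = w ! k" if "n \<ge> m" for n
    using that by (metis le_add_diff_inverse lessI nth_take)
  show ?thesis unfolding kept_def w_def[symmetric] by (intro exI[of _ k] exI[of _ m]) (simp add: *)
qed

text \<open>If U misses w this is some unspecified number; the symmetry argument only requires a
  fixed function of the path.\<close>

definition first_index :: "'a list \<Rightarrow> 'a set \<Rightarrow> nat" where
  "first_index w U = (LEAST i. i < length w \<and> w ! i \<in> U)"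

text \<open>The witness is the first entry of the erased path in A - B met by the future of y. The
  future of x meets no earlier entry of A: those outside B by comparison of the indices, those in B
  by avoidance. A tie is allowed since a return to an entry does not erase it.\<close>

lemma triple_hit_if_first_index_le:
  fixes x y z :: "nat \<Rightarrow> 'a"
  defines "A \<equiv> range z"
  assumes xy: "x m = y k" and v: "y k \<in> A" "y k \<notin> B"
    and avoid: "\<And>t. x (m + t) \<notin> B"
    and le: "first_index (erased_path A x m) ((A - B) \<inter> range (\<lambda>t. y (k + t)))
      \<le> first_index (erased_path A x m) ((A - B) \<inter> range (\<lambda>t. x (m + t)))"
  shows "triple_hit B x y z"
proof -
  define w where "w = erased_path A x m"
  define i where "i = first_index w ((A - B) \<inter> range (\<lambda>t. y (k + t)))"
  have "w \<noteq> []" "last w = y k" using erased_path_last[of A x m] xy by (auto simp: w_def)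
  \<comment> \<open>The common vertex is the last entry of w and is met by the future of y at once,
    so the least index exists.\<close>
  then have "length w - 1 < length w \<and> w ! (length w - 1) \<in> (A - B) \<inter> range (\<lambda>t. y (k + t))"
    using v by (auto simp: last_conv_nth intro: range_eqI[of _ _ 0])
  then have i: "i < length w \<and> w ! i \<in> (A - B) \<inter> range (\<lambda>t. y (k + t))"
    unfolding i_def first_index_def by (rule LeastI)
  have "kept A x (w ! i)"
    unfolding w_def
  proof (rule kept_if_never_hit_before)
    show "i < length (erased_path A x m)" using i by (simp add: w_def)
    fix j t assume j: "j < i" "erased_path A x m ! j \<in> A"
    show "x (m + t) \<noteq> erased_path A x m ! j"
    proof
      assume hit: "x (m + t) = erased_path A x m ! j"
      have "j < length w \<and> w ! j \<in> (A - B) \<inter> range (\<lambda>t. x (m + t))"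
        using j i avoid[of t] hit[symmetric] by (auto simp: w_def)
      then have "first_index w ((A - B) \<inter> range (\<lambda>t. x (m + t))) \<le> j"
        unfolding first_index_def by (rule Least_le)
      with le j show False by (simp add: w_def i_def)
    qed
  qed
  with i show ?thesis unfolding triple_hit_def A_def by blast
qed

lemma in_range_iff: "v \<in> range f \<longleftrightarrow> (\<exists>k. f k = v)"
  by (metis imageE rangeI)

section \<open>Measurability of the erasure and a second moment inequality\<close>

lemma measurable_erased_path:
  fixes X Z :: "nat \<Rightarrow> 'w \<Rightarrow> 'a :: countable"
  assumes [measurable]: "\<And>i. X i \<in> M \<rightarrow>\<^sub>M count_space UNIV" "\<And>i. Z i \<in> M \<rightarrow>\<^sub>M count_space UNIV"
  shows "(\<lambda>\<omega>. erased_path (range (\<lambda>k. Z k \<omega>)) (\<lambda>m. X m \<omega>) m) \<in> M \<rightarrow>\<^sub>M count_space UNIV"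
proof (induction m)
  case 0
  have "(\<lambda>\<omega>. [X 0 \<omega>]) \<in> M \<rightarrow>\<^sub>M count_space UNIV"
    by (rule measurable_compose[OF assms(1)]) simp
  then show ?case by simp
next
  case (Suc m)
  \<comment> \<open>One erasure step sees the infinite path Z only through the truth value b; the
    other arguments range over countable types, so measurability can be checked for fixed
    values.\<close>
  define g where "g = (\<lambda>w v b. if b \<and> v \<in> set w
         then take (Suc (LEAST i. i < length w \<and> w ! i = v)) w else w @ [v :: 'a])"
  have "Measurable.pred M (\<lambda>\<omega>. \<exists>k. Z k \<omega> = v)" for v by measurable
  then have "(\<lambda>\<omega>. g w v (\<exists>k. Z k \<omega> = v)) \<in> M \<rightarrow>\<^sub>M count_space UNIV" for w v
    by (rule measurable_compose) simp
  from measurable_compose_countable[OF this assms(1)]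
  have "(\<lambda>\<omega>. g w (X (Suc m) \<omega>) (\<exists>k. Z k \<omega> = X (Suc m) \<omega>)) \<in> M \<rightarrow>\<^sub>M count_space UNIV" for w .
  from measurable_compose_countable[OF this Suc]
  have "(\<lambda>\<omega>. g (erased_path (range (\<lambda>k. Z k \<omega>)) (\<lambda>m. X m \<omega>) m) (X (Suc m) \<omega>)
      (\<exists>k. Z k \<omega> = X (Suc m) \<omega>)) \<in> M \<rightarrow>\<^sub>M count_space UNIV" .
  also have "(\<lambda>\<omega>. g (erased_path (range (\<lambda>k. Z k \<omega>)) (\<lambda>m. X m \<omega>) m) (X (Suc m) \<omega>)
      (\<exists>k. Z k \<omega> = X (Suc m) \<omega>)) = (\<lambda>\<omega>. erased_path (range (\<lambda>k. Z k \<omega>)) (\<lambda>m. X m \<omega>) (Suc m))"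
  proof
    fix \<omega>
    have "(X (Suc m) \<omega> \<in> range (\<lambda>k. Z k \<omega>)) = (\<exists>k. Z k \<omega> = X (Suc m) \<omega>)"
      by (rule in_range_iff)
    then show "g (erased_path (range (\<lambda>k. Z k \<omega>)) (\<lambda>m. X m \<omega>) m) (X (Suc m) \<omega>) (\<exists>k. Z k \<omega> = X (Suc m) \<omega>)
        = erased_path (range (\<lambda>k. Z k \<omega>)) (\<lambda>m. X m \<omega>) (Suc m)"
      by (simp add: g_def Let_def)
  qed
  finally show ?case .
qed

lemma pred_triple_hit:
  fixes X Y Z :: "nat \<Rightarrow> 'w \<Rightarrow> 'a :: countable"
  assumes [measurable]: "\<And>i. X i \<in> M \<rightarrow>\<^sub>M count_space UNIV" "\<And>i. Y i \<in> M \<rightarrow>\<^sub>M count_space UNIV"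
    "\<And>i. Z i \<in> M \<rightarrow>\<^sub>M count_space UNIV"
  shows "Measurable.pred M (\<lambda>\<omega>. triple_hit B (\<lambda>i. X i \<omega>) (\<lambda>i. Y i \<omega>) (\<lambda>i. Z i \<omega>))"
proof -
  define L where "L = (\<lambda>n \<omega>. erased_path (range (\<lambda>k. Z k \<omega>)) (\<lambda>m. X m \<omega>) n)"
  have [measurable]: "Measurable.pred M (\<lambda>\<omega>. k < length (L n \<omega>) \<and> L n \<omega> ! k = v)" for k n v
    unfolding L_def by (rule measurable_compose[OF measurable_erased_path[OF assms(1,3)]]) simp
  have "Measurable.pred M (\<lambda>\<omega>. \<exists>v. v \<notin> B \<and> (\<exists>k. Z k \<omega> = v) \<and> (\<exists>k. Y k \<omega> = v) \<and>
      (\<exists>k m. \<forall>n. n \<ge> m \<longrightarrow> k < length (L n \<omega>) \<and> L n \<omega> ! k = v))"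
    by measurable
  also have "(\<lambda>\<omega>. \<exists>v. v \<notin> B \<and> (\<exists>k. Z k \<omega> = v) \<and> (\<exists>k. Y k \<omega> = v) \<and>
      (\<exists>k m. \<forall>n. n \<ge> m \<longrightarrow> k < length (L n \<omega>) \<and> L n \<omega> ! k = v))
      = (\<lambda>\<omega>. triple_hit B (\<lambda>i. X i \<omega>) (\<lambda>i. Y i \<omega>) (\<lambda>i. Z i \<omega>))"
  proof -
    have "v \<in> range f \<longleftrightarrow> (\<exists>k. f k = v)" for v :: 'a and f :: "nat \<Rightarrow> 'a"
      by (rule in_range_iff)
    then show ?thesis by (simp add: triple_hit_def kept_def L_def)
  qed
  finally show ?thesis .
qed

text \<open>Cauchy-Schwarz for the product of the number S of occurring events H i and the indicator
  of E. It is derived from the pointwise bound S \<le> c S^2 / 2 + 1 / (2 c), and c = a / b is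
  optimal when E has probability a^2 / b.\<close>

lemma (in prob_space) second_moment_lower_bound:
  assumes I: "finite I" and H [measurable]: "\<And>i. i \<in> I \<Longrightarrow> H i \<in> events" and E [measurable]: "E \<in> events"
    and a: "a > 0" "a \<le> (\<Sum>i\<in>I. prob (H i \<inter> E))"
    and b: "(\<Sum>i\<in>I. \<Sum>j\<in>I. prob (H i \<inter> H j)) \<le> b" "b > 0"
  shows "a\<^sup>2 / b \<le> prob E"
proof -
  define c where "c = a / b"
  have c: "c > 0" using a b by (simp add: c_def)
  define S where "S = (\<lambda>\<omega>. \<Sum>i\<in>I. indicator (H i) \<omega> :: real)"
  have pointwise: "(\<Sum>i\<in>I. indicator (H i \<inter> E) \<omega>)
      \<le> c / 2 * (\<Sum>i\<in>I. \<Sum>j\<in>I. indicator (H i \<inter> H j) \<omega>) + 1 / (2 * c) * indicator E \<omega>" for \<omega>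
  proof -
    have 1: "(\<Sum>i\<in>I. indicator (H i \<inter> E) \<omega>) = S \<omega> * indicator E \<omega>"
      by (simp add: S_def sum_distrib_right indicator_inter_arith)
    have 2: "(\<Sum>i\<in>I. \<Sum>j\<in>I. indicator (H i \<inter> H j) \<omega>) = (S \<omega>)\<^sup>2"
      by (simp add: S_def power2_eq_square sum_product indicator_inter_arith)
    have "0 \<le> (c * S \<omega> - 1)\<^sup>2 / (2 * c)" using c by simp
    also have "\<dots> = c / 2 * (S \<omega>)\<^sup>2 + 1 / (2 * c) - S \<omega>"
      using c by (simp add: field_simps power2_eq_square)
    finally have "S \<omega> \<le> c / 2 * (S \<omega>)\<^sup>2 + 1 / (2 * c)" by simp
    moreover have "0 \<le> c / 2 * (S \<omega>)\<^sup>2" using c by simp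
    ultimately show ?thesis unfolding 1 2 by (simp add: indicator_def)
  qed
  have "(\<Sum>i\<in>I. prob (H i \<inter> E)) = expectation (\<lambda>\<omega>. \<Sum>i\<in>I. indicator (H i \<inter> E) \<omega>)"
    using H E by (subst Bochner_Integration.integral_sum) (auto simp: emeasure_eq_measure)
  also have "\<dots> \<le> expectation (\<lambda>\<omega>. c / 2 * (\<Sum>i\<in>I. \<Sum>j\<in>I. indicator (H i \<inter> H j) \<omega>) + 1 / (2 * c) * indicator E \<omega>)"
    using H E pointwise
    by (intro integral_mono Bochner_Integration.integrable_add Bochner_Integration.integrable_sum integrable_mult_right)
      (auto simp: emeasure_eq_measure)
  also have "\<dots> = c / 2 * (\<Sum>i\<in>I. \<Sum>j\<in>I. prob (H i \<inter> H j)) + 1 / (2 * c) * prob E"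
    using H E by (simp add: emeasure_eq_measure)
  also have "\<dots> \<le> c / 2 * b + 1 / (2 * c) * prob E"
    using b(1) c by (intro add_right_mono mult_left_mono) auto
  finally have "a \<le> c / 2 * b + 1 / (2 * c) * prob E" using a(2) by linarith
  then have "a / 2 \<le> b / (2 * a) * prob E" using a b by (simp add: c_def)
  then show ?thesis using a b by (simp add: field_simps power2_eq_square)
qed

section \<open>Resampling the future of the walks\<close>

text \<open>For independent s and t with law M, g s t again has law M. The iterated integral is what
  allows conditioning on the retained part s.\<close>

definition resamples :: "'a measure \<Rightarrow> ('a \<Rightarrow> 'a \<Rightarrow> 'a) \<Rightarrow> bool" where
  "resamples M g \<longleftrightarrow> case_prod g \<in> M \<Otimes>\<^sub>M M \<rightarrow>\<^sub>M M \<and>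
     (\<forall>f\<in>borel_measurable M. (\<integral>\<^sup>+s. f s \<partial>M) = (\<integral>\<^sup>+s. (\<integral>\<^sup>+t. f (g s t) \<partial>M) \<partial>M))"

lemma nn_integral_resamples:
  "resamples M g \<Longrightarrow> f \<in> borel_measurable M \<Longrightarrow> (\<integral>\<^sup>+s. f s \<partial>M) = (\<integral>\<^sup>+s. (\<integral>\<^sup>+t. f (g s t) \<partial>M) \<partial>M)"
  by (simp add: resamples_def)

lemma resamples_comb_seq: "resamples step_space (comb_seq m)"
  unfolding resamples_def
  using nn_integral_step_space_comb_seq measurable_comb_seq[of m "measure_pmf step_pmf"] by auto

text \<open>Independent components can be resampled separately, each by its own rule; this matters
  because X and Y reach a common vertex at different times.\<close>

lemma resamples_pair:
  assumes M: "prob_space M" and N: "prob_space N" and g: "resamples M g" and h: "resamples N h"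
  shows "resamples (M \<Otimes>\<^sub>M N) (\<lambda>p q. (g (fst p) (fst q), h (snd p) (snd q)))"
proof -
  interpret M: prob_space M by fact
  interpret N: prob_space N by fact
  interpret MN: pair_prob_space M N ..
  have gm: "case_prod g \<in> M \<Otimes>\<^sub>M M \<rightarrow>\<^sub>M M" and hm: "case_prod h \<in> N \<Otimes>\<^sub>M N \<rightarrow>\<^sub>M N"
    using g h by (auto simp: resamples_def)
  have gm': "(\<lambda>k. g (a k) (b k)) \<in> K \<rightarrow>\<^sub>M M"
    if "a \<in> K \<rightarrow>\<^sub>M M" "b \<in> K \<rightarrow>\<^sub>M M" for a b and K :: "(('a \<times> 'b) \<times> ('a \<times> 'b)) measure"
    using measurable_compose[OF measurable_Pair[OF that] gm] by simp
  have hm': "(\<lambda>k. h (a k) (b k)) \<in> K \<rightarrow>\<^sub>M N"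
    if "a \<in> K \<rightarrow>\<^sub>M N" "b \<in> K \<rightarrow>\<^sub>M N" for a b and K :: "(('a \<times> 'b) \<times> ('a \<times> 'b)) measure"
    using measurable_compose[OF measurable_Pair[OF that] hm] by simp
  have meas: "(\<lambda>(p, q). (g (fst p) (fst q), h (snd p) (snd q)))
      \<in> (M \<Otimes>\<^sub>M N) \<Otimes>\<^sub>M (M \<Otimes>\<^sub>M N) \<rightarrow>\<^sub>M M \<Otimes>\<^sub>M N"
    unfolding case_prod_beta by (intro measurable_Pair gm' hm') measurable
  have "(\<integral>\<^sup>+s. f s \<partial>(M \<Otimes>\<^sub>M N)) = (\<integral>\<^sup>+p. (\<integral>\<^sup>+q. f (g (fst p) (fst q), h (snd p) (snd q)) \<partial>(M \<Otimes>\<^sub>M N)) \<partial>(M \<Otimes>\<^sub>M N))"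
    if f: "f \<in> borel_measurable (M \<Otimes>\<^sub>M N)" for f
  proof -
    define k where "k = (\<lambda>r. f (g (fst (fst r)) (fst (snd r)), h (snd (fst r)) (snd (snd r))))"
    have k: "k \<in> borel_measurable ((M \<Otimes>\<^sub>M N) \<Otimes>\<^sub>M (M \<Otimes>\<^sub>M N))"
      using measurable_compose[OF meas f] by (simp add: k_def case_prod_beta)
    have kc: "(\<lambda>t. k ((a t, b t), (c t, d t))) \<in> borel_measurable K"
      if "a \<in> K \<rightarrow>\<^sub>M M" "b \<in> K \<rightarrow>\<^sub>M N" "c \<in> K \<rightarrow>\<^sub>M M" "d \<in> K \<rightarrow>\<^sub>M N" for a b c d and K :: "'z measure"
      by (rule measurable_compose[OF _ k]) (intro measurable_Pair that)
    have hf: "(\<lambda>t. f (a t, h (b t) (d t))) \<in> borel_measurable K"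
      if "a \<in> K \<rightarrow>\<^sub>M M" "b \<in> K \<rightarrow>\<^sub>M N" "d \<in> K \<rightarrow>\<^sub>M N" for a b d and K :: "'z measure"
    proof -
      have "(\<lambda>t. h (b t) (d t)) \<in> K \<rightarrow>\<^sub>M N"
        using measurable_compose[OF measurable_Pair[OF that(2,3)] hm] by simp
      then show ?thesis by (intro measurable_compose[OF _ f] measurable_Pair that)
    qed
    have "(\<integral>\<^sup>+s. f s \<partial>(M \<Otimes>\<^sub>M N)) = (\<integral>\<^sup>+x. (\<integral>\<^sup>+y. f (x, y) \<partial>N) \<partial>M)"
      using f by (rule N.nn_integral_fst[symmetric])
    also have "\<dots> = (\<integral>\<^sup>+x. (\<integral>\<^sup>+y. (\<integral>\<^sup>+y'. f (x, h y y') \<partial>N) \<partial>N) \<partial>M)"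
    proof (rule nn_integral_cong)
      fix x assume "x \<in> space M"
      then have "(\<lambda>y. f (x, y)) \<in> borel_measurable N" using f by measurable
      then show "(\<integral>\<^sup>+y. f (x, y) \<partial>N) = (\<integral>\<^sup>+y. (\<integral>\<^sup>+y'. f (x, h y y') \<partial>N) \<partial>N)"
        using h by (simp add: resamples_def)
    qed
    also have "\<dots> = (\<integral>\<^sup>+x. (\<integral>\<^sup>+x'. (\<integral>\<^sup>+y. (\<integral>\<^sup>+y'. f (g x x', h y y') \<partial>N) \<partial>N) \<partial>M) \<partial>M)"
    proof -
      have "(\<lambda>x. \<integral>\<^sup>+y. (\<integral>\<^sup>+y'. f (x, h y y') \<partial>N) \<partial>N) \<in> borel_measurable M"
        by (rule N.borel_measurable_nn_integral, simp only: case_prod_beta',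
            rule N.borel_measurable_nn_integral, simp only: case_prod_beta', rule hf) measurable
      then show ?thesis using g by (simp add: resamples_def)
    qed
    also have "\<dots> = (\<integral>\<^sup>+x. (\<integral>\<^sup>+x'. (\<integral>\<^sup>+y. (\<integral>\<^sup>+y'. k ((x, y), (x', y')) \<partial>N) \<partial>N) \<partial>M) \<partial>M)"
      by (simp add: k_def)
    \<comment> \<open>Exchanging y and x' puts both retained parts outside and both fresh parts
      inside.\<close>
    also have "\<dots> = (\<integral>\<^sup>+x. (\<integral>\<^sup>+y. (\<integral>\<^sup>+x'. (\<integral>\<^sup>+y'. k ((x, y), (x', y')) \<partial>N) \<partial>M) \<partial>N) \<partial>M)"
    proof (rule nn_integral_cong)
      fix x assume x: "x \<in> space M"
      show "(\<integral>\<^sup>+x'. (\<integral>\<^sup>+y. (\<integral>\<^sup>+y'. k ((x, y), (x', y')) \<partial>N) \<partial>N) \<partial>M)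
          = (\<integral>\<^sup>+y. (\<integral>\<^sup>+x'. (\<integral>\<^sup>+y'. k ((x, y), (x', y')) \<partial>N) \<partial>M) \<partial>N)"
        by (rule MN.Fubini'[symmetric])
          (simp only: case_prod_beta', rule N.borel_measurable_nn_integral,
            simp only: case_prod_beta', rule kc, use x in measurable)
    qed
    also have "\<dots> = (\<integral>\<^sup>+x. (\<integral>\<^sup>+y. (\<integral>\<^sup>+q. k ((x, y), q) \<partial>(M \<Otimes>\<^sub>M N)) \<partial>N) \<partial>M)"
      by (intro nn_integral_cong N.nn_integral_fst) (use k in measurable)
    also have "\<dots> = (\<integral>\<^sup>+p. (\<integral>\<^sup>+q. k (p, q) \<partial>(M \<Otimes>\<^sub>M N)) \<partial>(M \<Otimes>\<^sub>M N))"
      by (rule N.nn_integral_fst[of "\<lambda>p. \<integral>\<^sup>+q. k (p, q) \<partial>(M \<Otimes>\<^sub>M N)"])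
        (intro MN.borel_measurable_nn_integral_fst k)
    finally show ?thesis by (simp add: k_def case_prod_beta)
  qed
  with meas show ?thesis by (simp add: resamples_def)
qed

abbreviation "step_space2 \<equiv> step_space \<Otimes>\<^sub>M step_space"

lemma space_step_space2 [simp]: "space step_space2 = UNIV"
  by (simp add: space_pair_measure)

text \<open>The comparison of indices has probability at least 1/2 by symmetry, and the first walk
  hits B with probability at most 1/4.\<close>

lemma prob_avoid_and_first_index_le:
  assumes B: "finite B" "(\<Sum>b\<in>B. green (v - b)) \<le> 1 / 4"
  shows "ennreal (1 / 4) \<le> emeasure step_space2
    {q. (\<forall>j. walk v (fst q) j \<notin> B) \<and>
      first_index w (U \<inter> range (walk v (snd q))) \<le> first_index w (U \<inter> range (walk v (fst q)))}"
proof -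
  define f where "f = (\<lambda>t. first_index w (U \<inter> range (walk v t)))"
  have [measurable]: "f \<in> step_space \<rightarrow>\<^sub>M count_space UNIV"
  proof -
    have "(\<lambda>t. LEAST i. i < length w \<and> w ! i \<in> U \<and> (\<exists>j. walk v t j = w ! i)) \<in> step_space \<rightarrow>\<^sub>M count_space UNIV"
      by measurable
    also have "(\<lambda>t. LEAST i. i < length w \<and> w ! i \<in> U \<and> (\<exists>j. walk v t j = w ! i)) = f"
      by (simp add: f_def first_index_def in_range_iff fun_eq_iff)
    finally show ?thesis .
  qed
  define D1 where "D1 = {q. f (snd q) \<le> f (fst q)}"
  define D2 where "D2 = {q :: (nat \<Rightarrow> int ^ 3) \<times> (nat \<Rightarrow> int ^ 3). \<exists>j. walk v (fst q) j \<in> B}"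
  have D1: "measure step_space2 D1 \<ge> 1 / 2"
    unfolding D1_def by (rule prob_iid_le_ge_half) measurable
  \<comment> \<open>A set outside the \<sigma>-algebra would have measure 0.\<close>
  then have D1s: "D1 \<in> sets step_space2" using measure_notin_sets[of D1 step_space2] by force
  have hs: "{t. \<exists>j. walk v t j \<in> B} \<in> sets step_space"
    by (rule sets_step_spaceI) measurable
  have D2t: "D2 = {t. \<exists>j. walk v t j \<in> B} \<times> space step_space" by (auto simp: D2_def)
  with hs have D2s: "D2 \<in> sets step_space2"
    by (simp only: D2t pair_measureI sets.top)
  have "emeasure step_space2 D2 = emeasure step_space {t. \<exists>j. walk v t j \<in> B}"
    using hs by (simp only: D2t steps.P.emeasure_pair_measure_Times sets.top steps.P.emeasure_space_1 mult_1_right)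
  then have D2: "measure step_space2 D2 \<le> 1 / 4"
    using prob_walk_hits_le[OF B(1), of v] B(2) by (simp add: measure_def)
  have "measure step_space2 D1 \<le> measure step_space2 ((D1 - D2) \<union> D2)"
    using D1s D2s by (intro step_pair.P.finite_measure_mono) auto
  also have "\<dots> \<le> measure step_space2 (D1 - D2) + measure step_space2 D2"
    using D1s D2s by (intro measure_Un_le) auto
  finally have "measure step_space2 (D1 - D2) \<ge> 1 / 4" using D1 D2 by linarith
  then have "ennreal (1 / 4) \<le> emeasure step_space2 (D1 - D2)"
    by (simp only: step_pair.P.emeasure_eq_measure ennreal_leI)
  also have "D1 - D2 = {q. (\<forall>j. walk v (fst q) j \<notin> B) \<and>
      first_index w (U \<inter> range (walk v (snd q))) \<le> first_index w (U \<inter> range (walk v (fst q)))}"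
    by (auto simp: D1_def D2_def f_def)
  finally show ?thesis .
qed

text \<open>The segments r1 and r2 up to time n and the whole path z are fixed. Given that X and Y
  are at v after m and k further steps, their continuations are independent walks from v, so the
  symmetric comparison applies conditionally on the past.\<close>

lemma emeasure_triple_hit_given_z_ge:
  fixes r1 r2 :: "nat \<Rightarrow> int ^ 3" and x y :: "int ^ 3" and n :: nat
  assumes z: "v \<in> range z" and vB: "v \<notin> B" and B: "finite B" "(\<Sum>b\<in>B. green (v - b)) \<le> 1 / 4"
  defines "X \<equiv> \<lambda>s. walk x (comb_seq n r1 s)" and "Y \<equiv> \<lambda>s. walk y (comb_seq n r2 s)"
  shows "ennreal (1 / 4 * (ret_prob m (v - walk x r1 n) * ret_prob k (v - walk y r2 n)))
    \<le> emeasure step_space2 {p. X (fst p) (n + m) = v \<and> Y (snd p) (n + k) = v \<and> triple_hit B (X (fst p)) (Y (snd p)) z}"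
proof -
  let ?g = "\<lambda>p q. (comb_seq m (fst p) (fst q), comb_seq k (snd p) (snd q))"
  define Q where "Q = {p. X (fst p) (n + m) = v \<and> Y (snd p) (n + k) = v \<and> triple_hit B (X (fst p)) (Y (snd p)) z}"
  define R where "R = {s. walk (walk x r1 n) s m = v} \<times> {s. walk (walk y r2 n) s k = v}"
  have Xm: "(\<lambda>p. X (fst p) i) \<in> step_space2 \<rightarrow>\<^sub>M count_space UNIV"
    and Ym: "(\<lambda>p. Y (snd p) i) \<in> step_space2 \<rightarrow>\<^sub>M count_space UNIV" for i
    unfolding X_def Y_def by measurable
  have "Measurable.pred step_space2 (\<lambda>p. X (fst p) (n + m) = v \<and> Y (snd p) (n + k) = v \<and> triple_hit B (X (fst p)) (Y (snd p)) z)"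
    using Xm Ym pred_triple_hit[of "\<lambda>i p. X (fst p) i" step_space2 "\<lambda>i p. Y (snd p) i" "\<lambda>i p. z i" B]
    by simp
  then have Q: "Q \<in> sets step_space2" by (simp add: pred_def Q_def)
  have R: "R \<in> sets step_space2" unfolding R_def by (intro pair_measureI sets_walk_eq)
  have step: "ennreal (1 / 4) * indicator R p \<le> (\<integral>\<^sup>+q. indicator Q (?g p q) \<partial>step_space2)" for p
  proof (cases "p \<in> R")
    case True
    define w where "w = erased_path (range z) (X (fst p)) (n + m)"
    define G where "G = {q. (\<forall>j. walk v (fst q) j \<notin> B) \<and>
      first_index w ((range z - B) \<inter> range (walk v (snd q))) \<le> first_index w ((range z - B) \<inter> range (walk v (fst q)))}"
    have "ennreal (1 / 4) \<le> emeasure step_space2 G"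
      unfolding G_def using B by (rule prob_avoid_and_first_index_le)
    also have "\<dots> \<le> emeasure step_space2 {q. ?g p q \<in> Q}"
    proof (rule emeasure_mono)
      show "G \<subseteq> {q. ?g p q \<in> Q}"
      proof
        fix q assume q: "q \<in> G"
        define x' y' where "x' = X (comb_seq m (fst p) (fst q))" and "y' = Y (comb_seq k (snd p) (snd q))"
        have x't: "x' (n + m + t) = walk v (fst q) t" for t
        proof -
          have "x' (n + (m + t)) = walk (walk (walk x r1 n) (fst p) m) (fst q) t"
            by (simp only: x'_def X_def walk_comb_seq_add)
          with True show ?thesis by (auto simp: R_def add.assoc)
        qed
        have y't: "y' (n + k + t) = walk v (snd q) t" for t
        proof -
          have "y' (n + (k + t)) = walk (walk (walk y r2 n) (snd p) k) (snd q) t"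
            by (simp only: y'_def Y_def walk_comb_seq_add)
          with True show ?thesis by (auto simp: R_def add.assoc)
        qed
        have "x' i = X (fst p) i" if "i \<le> n + m" for i
        proof (cases "i \<le> n")
          case True
          then show ?thesis by (simp add: x'_def X_def walk_comb_seq_le)
        next
          case False
          then obtain j where "i = n + j" using le_Suc_ex[of n i] by auto
          moreover from this that have "j \<le> m" by simp
          ultimately show ?thesis by (simp add: x'_def X_def walk_comb_seq_add walk_comb_seq_le)
        qed
        \<comment> \<open>Since z is frozen, the erased path at the hitting time depends on the
          retained part p alone, so both futures q are compared along the same list.\<close>
        then have w: "erased_path (range z) x' (n + m) = w"
          unfolding w_def by (intro erased_path_cong)
        have x'0: "x' (n + m) = v" and y'0: "y' (n + k) = v"
          using x't[of 0] y't[of 0] by simp_all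
        have "triple_hit B x' y' z"
        proof (rule triple_hit_if_first_index_le)
          show "first_index (erased_path (range z) x' (n + m)) ((range z - B) \<inter> range (\<lambda>t. y' (n + k + t)))
              \<le> first_index (erased_path (range z) x' (n + m)) ((range z - B) \<inter> range (\<lambda>t. x' (n + m + t)))"
            unfolding w x't y't using q by (simp add: G_def)
        qed (use q x'0 y'0 x't z vB in \<open>auto simp: G_def\<close>)
        with x'0 y'0 show "q \<in> {q. ?g p q \<in> Q}" by (simp add: Q_def x'_def y'_def)
      qed
      have "?g p \<in> step_space2 \<rightarrow>\<^sub>M step_space2" by measurable
      from measurable_sets[OF this Q] show "{q. ?g p q \<in> Q} \<in> sets step_space2" by (simp add: vimage_def)
    qed
    also have "\<dots> = (\<integral>\<^sup>+q. indicator {q. ?g p q \<in> Q} q \<partial>step_space2)"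
    proof (rule nn_integral_indicator[symmetric])
      have "?g p \<in> step_space2 \<rightarrow>\<^sub>M step_space2" by measurable
      from measurable_sets[OF this Q] show "{q. ?g p q \<in> Q} \<in> sets step_space2" by (simp add: vimage_def)
    qed
    also have "\<dots> = (\<integral>\<^sup>+q. indicator Q (?g p q) \<partial>step_space2)"
      by (intro nn_integral_cong) (simp add: indicator_def)
    finally show ?thesis using True by simp
  qed simp
  have "ennreal (1 / 4 * (ret_prob m (v - walk x r1 n) * ret_prob k (v - walk y r2 n)))
      = ennreal (1 / 4) * emeasure step_space2 R"
    unfolding R_def
    by (subst steps.P.emeasure_pair_measure_Times) (simp_all add: emeasure_walk_eq ret_prob_nonneg flip: ennreal_mult)
  also have "\<dots> = (\<integral>\<^sup>+p. ennreal (1 / 4) * indicator R p \<partial>step_space2)"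
    using R by (rule nn_integral_cmult_indicator[symmetric])
  also have "\<dots> \<le> (\<integral>\<^sup>+p. (\<integral>\<^sup>+q. indicator Q (?g p q) \<partial>step_space2) \<partial>step_space2)"
    by (intro nn_integral_mono step)
  also have "\<dots> = (\<integral>\<^sup>+p. indicator Q p \<partial>step_space2)"
    by (rule nn_integral_resamples[OF resamples_pair[OF steps.P.prob_space_axioms steps.P.prob_space_axioms
          resamples_comb_seq resamples_comb_seq], of "indicator Q", symmetric])
      (rule borel_measurable_indicator[OF Q])
  also have "\<dots> = emeasure step_space2 Q" using Q by simp
  finally show ?thesis unfolding Q_def .
qed

section \<open>Second moment bound\<close>

abbreviation "step_space3 \<equiv> step_space \<Otimes>\<^sub>M step_space2"

interpretation step_triple: pair_prob_space step_space step_space2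
  by unfold_locales

lemma space_step_space3 [simp]: "space step_space3 = UNIV"
  by (simp add: space_pair_measure)

text \<open>A point of \<open>step_space3\<close> is \<open>(s\<^sub>3, s\<^sub>1, s\<^sub>2)\<close> with \<open>s\<^sub>1\<close>, \<open>s\<^sub>2\<close>, \<open>s\<^sub>3\<close> the steps of
  the walks \<open>X\<close>, \<open>Y\<close>, \<open>Z\<close>.\<close>

definition hit_event ::
  "(int ^ 3) set \<Rightarrow> ((nat \<Rightarrow> int ^ 3) \<Rightarrow> nat \<Rightarrow> int ^ 3) \<Rightarrow> ((nat \<Rightarrow> int ^ 3) \<Rightarrow> nat \<Rightarrow> int ^ 3) \<Rightarrow>
    ((nat \<Rightarrow> int ^ 3) \<Rightarrow> nat \<Rightarrow> int ^ 3) \<Rightarrow> ((nat \<Rightarrow> int ^ 3) \<times> (nat \<Rightarrow> int ^ 3) \<times> (nat \<Rightarrow> int ^ 3)) set"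
where
  "hit_event B X Y Z = {\<omega>. triple_hit B (X (fst (snd \<omega>))) (Y (snd (snd \<omega>))) (Z (fst \<omega>))}"

lemma sets_hit_event:
  assumes "\<And>i. (\<lambda>s. X s i) \<in> step_space \<rightarrow>\<^sub>M count_space UNIV" "\<And>i. (\<lambda>s. Y s i) \<in> step_space \<rightarrow>\<^sub>M count_space UNIV"
    "\<And>i. (\<lambda>s. Z s i) \<in> step_space \<rightarrow>\<^sub>M count_space UNIV"
  shows "hit_event B X Y Z \<in> sets step_space3"
proof -
  have "(\<lambda>\<omega>. fst (snd \<omega>)) \<in> step_space3 \<rightarrow>\<^sub>M step_space" "(\<lambda>\<omega>. snd (snd \<omega>)) \<in> step_space3 \<rightarrow>\<^sub>M step_space"
    "fst \<in> step_space3 \<rightarrow>\<^sub>M step_space"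
    by (intro measurable_compose[OF measurable_snd] measurable_fst measurable_snd)+
  note proj = this
  have "Measurable.pred step_space3
      (\<lambda>\<omega>. triple_hit B (\<lambda>i. X (fst (snd \<omega>)) i) (\<lambda>i. Y (snd (snd \<omega>)) i) (\<lambda>i. Z (fst \<omega>) i))"
    by (rule pred_triple_hit[OF measurable_compose[OF proj(1) assms(1)]
          measurable_compose[OF proj(2) assms(2)] measurable_compose[OF proj(3) assms(3)]])
  then show ?thesis by (simp add: pred_def hit_event_def)
qed

lemma measurable_walk_comb_seq: "(\<lambda>s. walk x (comb_seq n r s) i) \<in> step_space \<rightarrow>\<^sub>M count_space UNIV"
  by measurable

text \<open>Slice along the path of Z. If Z visits v, the slice satisfies the preceding bound;
  integrating over Z adds the factor for its visit.\<close>

lemma prob_hit_event_ge: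
  fixes x y z v :: "int ^ 3" and r1 r2 r3 :: "nat \<Rightarrow> int ^ 3" and n m k l :: nat
  assumes vB: "v \<notin> B" and B: "finite B" "(\<Sum>b\<in>B. green (v - b)) \<le> 1 / 4"
  defines "E \<equiv> hit_event B (\<lambda>s. walk x (comb_seq n r1 s)) (\<lambda>s. walk y (comb_seq n r2 s)) (\<lambda>s. walk z (comb_seq n r3 s))"
    and "H \<equiv> {s. walk (walk z r3 n) s l = v} \<times> ({s. walk (walk x r1 n) s m = v} \<times> {s. walk (walk y r2 n) s k = v})"
  shows "1 / 4 * (ret_prob l (v - walk z r3 n) * (ret_prob m (v - walk x r1 n) * ret_prob k (v - walk y r2 n)))
    \<le> measure step_space3 (H \<inter> E)"
proof -
  define c where "c = 1 / 4 * (ret_prob m (v - walk x r1 n) * ret_prob k (v - walk y r2 n))"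
  have c: "c \<ge> 0" by (simp add: c_def ret_prob_nonneg)
  define J where "J = {s. walk (walk z r3 n) s l = v}"
  have E: "E \<in> sets step_space3" unfolding E_def by (intro sets_hit_event measurable_walk_comb_seq)
  have H: "H \<in> sets step_space3" unfolding H_def by (intro pair_measureI sets_walk_eq)
  have "ennreal c * indicator J s \<le> emeasure step_space2 (Pair s -` (H \<inter> E))" for s
  proof (cases "s \<in> J")
    case True
    then have "walk z (comb_seq n r3 s) (n + l) = v" by (simp add: J_def walk_comb_seq_add)
    then have "v \<in> range (walk z (comb_seq n r3 s))" by blast
    from emeasure_triple_hit_given_z_ge[OF this vB B, of m x r1 n k y r2]
    have "ennreal c \<le> emeasure step_space2 {p. walk x (comb_seq n r1 (fst p)) (n + m) = v \<and>
        walk y (comb_seq n r2 (snd p)) (n + k) = v \<and>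
        triple_hit B (walk x (comb_seq n r1 (fst p))) (walk y (comb_seq n r2 (snd p))) (walk z (comb_seq n r3 s))}"
      by (simp only: c_def)
    also have "{p. walk x (comb_seq n r1 (fst p)) (n + m) = v \<and> walk y (comb_seq n r2 (snd p)) (n + k) = v \<and>
        triple_hit B (walk x (comb_seq n r1 (fst p))) (walk y (comb_seq n r2 (snd p))) (walk z (comb_seq n r3 s))}
        = Pair s -` (H \<inter> E)"
      using True by (auto simp: H_def E_def J_def hit_event_def walk_comb_seq_add)
    finally show ?thesis using True by simp
  qed simp
  then have "(\<integral>\<^sup>+s. ennreal c * indicator J s \<partial>step_space) \<le> (\<integral>\<^sup>+s. emeasure step_space2 (Pair s -` (H \<inter> E)) \<partial>step_space)"
    by (intro nn_integral_mono)
  also have "\<dots> = emeasure step_space3 (H \<inter> E)"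
    using H E by (intro step_pair.P.emeasure_pair_measure_alt[symmetric]) auto
  also have "(\<integral>\<^sup>+s. ennreal c * indicator J s \<partial>step_space) = ennreal c * ennreal (ret_prob l (v - walk z r3 n))"
    unfolding J_def by (subst nn_integral_cmult_indicator) (simp_all add: emeasure_walk_eq)
  finally have "ennreal (c * ret_prob l (v - walk z r3 n)) \<le> ennreal (measure step_space3 (H \<inter> E))"
    using c by (simp add: step_triple.P.emeasure_eq_measure ennreal_mult ret_prob_nonneg)
  then have "c * ret_prob l (v - walk z r3 n) \<le> measure step_space3 (H \<inter> E)"
    by simp
  then show ?thesis by (simp add: c_def mult_ac)
qed

text \<open>The initial segments enter only through the end points a, b, c, around which the good
  region is chosen. All constants are independent of these points and of B, so the bound is
  uniform.\<close>

lemma prob_hit_event_lower_bound: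
  fixes x y z :: "int ^ 3" and r1 r2 r3 :: "nat \<Rightarrow> int ^ 3" and n :: nat
  assumes B: "finite B"
  defines "E \<equiv> hit_event B (\<lambda>s. walk x (comb_seq n r1 s)) (\<lambda>s. walk y (comb_seq n r2 s)) (\<lambda>s. walk z (comb_seq n r3 s))"
  shows "1 / 2 ^ 18 \<le> measure step_space3 E"
proof -
  define a b c where "a = walk x r1 n" and "b = walk y r2 n" and "c = walk z r3 n"
  \<comment> \<open>Besides B itself, the region must omit the points from which the walk returns to
    B too easily.\<close>
  have "finite (B \<union> {v. (\<Sum>b\<in>B. green (v - b)) > 1 / 4})"
    using B finite_green_sum_gt[OF B, of "1 / 4"] by simp
  from obtain_good_region[OF _ this, of "{c, a, b}"] obtain L N where L: "finite L"
    and LB: "L \<inter> (B \<union> {v. (\<Sum>b\<in>B. green (v - b)) > 1 / 4}) = {}"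
    and pos: "(\<Sum>v\<in>L. green v ^ 3) > 0"
    and dist: "\<And>v. (\<Sum>w\<in>L. green (w - v) ^ 3) \<le> 4 * (\<Sum>w\<in>L. green w ^ 3)"
    and low: "\<And>u v. u \<in> {c, a, b} \<Longrightarrow> v \<in> L \<Longrightarrow> green v / 2 \<le> (\<Sum>n<N. ret_prob n (v - u))"
    and up: "\<And>u v. u \<in> {c, a, b} \<Longrightarrow> v \<in> L \<Longrightarrow> green (v - u) \<le> 2 * green v"
    by auto
  define \<sigma> where "\<sigma> = (\<Sum>v\<in>L. green v ^ 3)"
  define K where "K = {..<N}"
  define I where "I = L \<times> K \<times> K \<times> K"
  define H where "H = (\<lambda>(v, m, k, l). {s. walk c s l = v} \<times> ({s. walk a s m = v} \<times> {s. walk b s k = v}))"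
  have fin: "finite I" using L by (simp add: I_def K_def)
  have H: "H i \<in> sets step_space3" for i
    unfolding H_def by (auto split: prod.split intro!: pair_measureI sets_walk_eq)
  have E: "E \<in> sets step_space3"
    unfolding E_def by (intro sets_hit_event measurable_walk_comb_seq)
  have sum4: "(\<Sum>i\<in>I. F i) = (\<Sum>v\<in>L. \<Sum>m\<in>K. \<Sum>k\<in>K. \<Sum>l\<in>K. F (v, m, k, l))" for F :: "_ \<Rightarrow> real"
    by (simp add: I_def sum.cartesian_product case_prod_beta)
  have first: "\<sigma> / 32 \<le> (\<Sum>i\<in>I. measure step_space3 (H i \<inter> E))"
  proof -
    \<comment> \<open>The 1/4 is the conditional probability of a lasting triple hit; each 1/2
      compares a truncated, translated Green function with \<open>green v\<close>.\<close>
    have "\<sigma> / 32 = (\<Sum>v\<in>L. 1 / 4 * (green v / 2 * (green v / 2 * (green v / 2))))"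
      by (simp add: \<sigma>_def power3_eq_cube sum_divide_distrib mult.assoc)
    also have "\<dots> \<le> (\<Sum>v\<in>L. 1 / 4 * ((\<Sum>l\<in>K. ret_prob l (v - c)) * ((\<Sum>m\<in>K. ret_prob m (v - a)) * (\<Sum>k\<in>K. ret_prob k (v - b)))))"
      unfolding K_def
      by (intro sum_mono mult_left_mono mult_mono low mult_nonneg_nonneg sum_nonneg ret_prob_nonneg) (auto simp: green_nonneg)
    also have "\<dots> = (\<Sum>v\<in>L. \<Sum>m\<in>K. \<Sum>k\<in>K. \<Sum>l\<in>K. 1 / 4 * (ret_prob l (v - c) * (ret_prob m (v - a) * ret_prob k (v - b))))"
      by (simp only: sum_distrib_left[symmetric] sum_distrib_right[symmetric])
    also have "\<dots> \<le> (\<Sum>v\<in>L. \<Sum>m\<in>K. \<Sum>k\<in>K. \<Sum>l\<in>K. measure step_space3 (H (v, m, k, l) \<inter> E))"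
    proof (intro sum_mono)
      fix v m k l assume "v \<in> L"
      then have "v \<notin> B" "(\<Sum>b\<in>B. green (v - b)) \<le> 1 / 4" using LB by (auto simp: not_less)
      from prob_hit_event_ge[OF this(1) B this(2)]
      show "1 / 4 * (ret_prob l (v - c) * (ret_prob m (v - a) * ret_prob k (v - b)))
          \<le> measure step_space3 (H (v, m, k, l) \<inter> E)"
        unfolding H_def E_def a_def b_def c_def by simp
    qed
    finally show ?thesis by (simp only: sum4)
  qed
  define p where "p = (\<lambda>u v w m m'. measure step_space {s. walk u s m = v \<and> walk u s m' = w})"
  define M where "M = (\<lambda>u v w. green (v - u) * green (w - v) + green (w - u) * green (v - w))"
  have pM: "(\<Sum>m\<in>K. \<Sum>m'\<in>K. p u v w m m') \<le> M u v w" for u v w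
    unfolding K_def p_def M_def by (rule sum_prob_walk_pair_le)
  have pnn: "0 \<le> p u v w m m'" for u v w m m' by (simp add: p_def)
  have second: "(\<Sum>i\<in>I. \<Sum>j\<in>I. measure step_space3 (H i \<inter> H j)) \<le> 256 * \<sigma>\<^sup>2"
  proof -
    have "measure step_space3 (H (v, m, k, l) \<inter> H (w, m', k', l')) = p c v w l l' * (p a v w m m' * p b v w k k')"
      for v m k l w m' k' l'
    proof -
      have "H (v, m, k, l) \<inter> H (w, m', k', l')
          = {s. walk c s l = v \<and> walk c s l' = w} \<times> ({s. walk a s m = v \<and> walk a s m' = w} \<times> {s. walk b s k = v \<and> walk b s k' = w})"
        by (auto simp: H_def)
      then have "emeasure step_space3 (H (v, m, k, l) \<inter> H (w, m', k', l'))
          = emeasure step_space {s. walk c s l = v \<and> walk c s l' = w} *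
            (emeasure step_space {s. walk a s m = v \<and> walk a s m' = w} * emeasure step_space {s. walk b s k = v \<and> walk b s k' = w})"
        by (simp only: step_pair.P.emeasure_pair_measure_Times steps.P.emeasure_pair_measure_Times
            sets_walk_eq pair_measureI)
      then show ?thesis by (simp add: measure_def p_def enn2real_mult)
    qed
    then have "(\<Sum>i\<in>I. \<Sum>j\<in>I. measure step_space3 (H i \<inter> H j))
        = (\<Sum>v\<in>L. \<Sum>m\<in>K. \<Sum>k\<in>K. \<Sum>l\<in>K. \<Sum>w\<in>L. \<Sum>m'\<in>K. \<Sum>k'\<in>K. \<Sum>l'\<in>K. p c v w l l' * (p a v w m m' * p b v w k k'))"
      by (simp only: sum4)
    \<comment> \<open>With both points outermost, the six time sums separate into one double sum for
      each walk.\<close>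
    also have "\<dots> = (\<Sum>v\<in>L. \<Sum>w\<in>L. \<Sum>m\<in>K. \<Sum>k\<in>K. \<Sum>l\<in>K. \<Sum>m'\<in>K. \<Sum>k'\<in>K. \<Sum>l'\<in>K. p c v w l l' * (p a v w m m' * p b v w k k'))"
    proof (rule sum.cong[OF refl])
      fix v
      show "(\<Sum>m\<in>K. \<Sum>k\<in>K. \<Sum>l\<in>K. \<Sum>w\<in>L. \<Sum>m'\<in>K. \<Sum>k'\<in>K. \<Sum>l'\<in>K. p c v w l l' * (p a v w m m' * p b v w k k'))
          = (\<Sum>w\<in>L. \<Sum>m\<in>K. \<Sum>k\<in>K. \<Sum>l\<in>K. \<Sum>m'\<in>K. \<Sum>k'\<in>K. \<Sum>l'\<in>K. p c v w l l' * (p a v w m m' * p b v w k k'))"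
        by (simp only: sum.swap[of _ L])
    qed
    also have "\<dots> = (\<Sum>v\<in>L. \<Sum>w\<in>L. (\<Sum>l\<in>K. \<Sum>l'\<in>K. p c v w l l') *
        ((\<Sum>m\<in>K. \<Sum>m'\<in>K. p a v w m m') * (\<Sum>k\<in>K. \<Sum>k'\<in>K. p b v w k k')))"
      by (simp only: sum_distrib_left[symmetric] sum_distrib_right[symmetric])
    also have "\<dots> \<le> (\<Sum>v\<in>L. \<Sum>w\<in>L. M c v w * (M a v w * M b v w))"
      by (intro sum_mono mult_mono pM mult_nonneg_nonneg sum_nonneg pnn)
        (auto simp: M_def green_nonneg)
    also have "\<dots> \<le> 256 * \<sigma>\<^sup>2"
      unfolding M_def \<sigma>_def using L dist up by (rule double_green_sum_le)
    finally show ?thesis .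
  qed
  have "(\<sigma> / 32)\<^sup>2 / (256 * \<sigma>\<^sup>2) \<le> measure step_space3 E"
    using fin H E first second pos
    by (intro step_triple.P.second_moment_lower_bound[of I H]) (auto simp: \<sigma>_def)
  moreover have "(\<sigma> / 32)\<^sup>2 / (256 * \<sigma>\<^sup>2) = 1 / 2 ^ 18"
    using pos by (simp add: \<sigma>_def power_divide)
  ultimately show ?thesis by simp
qed

definition lattice_box :: "nat \<Rightarrow> (int ^ 3) set" where
  "lattice_box r = {x. \<forall>i. \<bar>x $ i\<bar> \<le> int r}"

lemma triple_hit_antimono: "B \<subseteq> C \<Longrightarrow> triple_hit C x y z \<Longrightarrow> triple_hit B x y z"
  unfolding triple_hit_def by blast

text \<open>The lower bound does not depend on the box, so it survives the decreasing limit.\<close>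

lemma prob_hit_all_boxes_lower_bound:
  "1 / 2 ^ 18 \<le> measure step_space3
    (\<Inter>r. hit_event (lattice_box r) (\<lambda>s. walk x (comb_seq n r1 s)) (\<lambda>s. walk y (comb_seq n r2 s)) (\<lambda>s. walk z (comb_seq n r3 s)))"
proof (rule LIMSEQ_le_const)
  let ?E = "\<lambda>r. hit_event (lattice_box r) (\<lambda>s. walk x (comb_seq n r1 s)) (\<lambda>s. walk y (comb_seq n r2 s)) (\<lambda>s. walk z (comb_seq n r3 s))"
  have "?E r \<in> sets step_space3" for r by (intro sets_hit_event measurable_walk_comb_seq)
  moreover have "decseq ?E"
  proof (rule decseq_SucI)
    fix r
    have "lattice_box r \<subseteq> lattice_box (Suc r)"
    proof
      fix x assume "x \<in> lattice_box r"
      then have "\<bar>x $ i\<bar> \<le> int r" for i by (simp add: lattice_box_def)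
      then have "\<bar>x $ i\<bar> \<le> int (Suc r)" for i by (rule order_trans) simp
      then show "x \<in> lattice_box (Suc r)" by (simp add: lattice_box_def)
    qed
    then show "?E (Suc r) \<subseteq> ?E r" unfolding hit_event_def using triple_hit_antimono by blast
  qed
  ultimately show "(\<lambda>r. measure step_space3 (?E r)) \<longlonglongrightarrow> measure step_space3 (\<Inter>r. ?E r)"
    by (intro step_triple.P.finite_Lim_measure_decseq) auto
  show "\<exists>N. \<forall>r\<ge>N. 1 / 2 ^ 18 \<le> measure step_space3 (?E r)"
    using prob_hit_event_lower_bound finite_box unfolding lattice_box_def by blast
qed

text \<open>A finite intersection would lie in some box, but the triple hit outside that box is
  again one of its points.\<close>

lemma infinite_if_triple_hit_all_boxes:
  assumes "\<And>r. triple_hit (lattice_box r) x y z"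
  shows "infinite (range (partial_loop_erasure (range z) x) \<inter> range y \<inter> range z)"
proof
  let ?T = "range (partial_loop_erasure (range z) x) \<inter> range y \<inter> range z"
  assume fin: "finite ?T"
  define r where "r = nat (\<Sum>v\<in>?T. \<Sum>i\<in>UNIV. \<bar>v $ i\<bar>)"
  have "?T \<subseteq> lattice_box r"
  proof
    fix v assume v: "v \<in> ?T"
    have "\<bar>v $ i\<bar> \<le> int r" for i
    proof -
      have "\<bar>v $ i\<bar> \<le> (\<Sum>i\<in>UNIV. \<bar>v $ i\<bar>)" by (rule member_le_sum) auto
      also have "\<dots> \<le> (\<Sum>v\<in>?T. \<Sum>i\<in>UNIV. \<bar>v $ i\<bar>)"
        using fin v by (intro member_le_sum[of v ?T "\<lambda>v. \<Sum>i\<in>UNIV. \<bar>v $ i\<bar>"]) (auto intro: sum_nonneg)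
      finally have le: "\<bar>v $ i\<bar> \<le> (\<Sum>v\<in>?T. \<Sum>i\<in>UNIV. \<bar>v $ i\<bar>)" .
      then have "0 \<le> (\<Sum>v\<in>?T. \<Sum>i\<in>UNIV. \<bar>v $ i\<bar>)" using abs_ge_zero by (rule order_trans[rotated])
      with le show ?thesis by (simp only: r_def nat_0_le)
    qed
    then show "v \<in> lattice_box r" by (simp add: lattice_box_def)
  qed
  moreover from assms[of r] obtain v
    where "v \<notin> lattice_box r" "v \<in> range z" "v \<in> range y" "kept (range z) x v"
    unfolding triple_hit_def by (elim exE conjE)
  moreover from this(4) have "v \<in> range (partial_loop_erasure (range z) x)" by (rule kept_in_range)
  ultimately show False by blast
qed

section \<open>Zero-one law and transfer\<close>

text \<open>The sets approximable in symmetric difference form a \<sigma>-algebra: a countable union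
  is first cut to finitely many members, each of which is then approximated.\<close>

lemma (in prob_space) sigma_sets_approximable:
  assumes G: "algebra (space M) G" "G \<subseteq> events" and D: "D \<in> sigma_sets (space M) G"
  shows "D \<in> events \<and> (\<forall>\<delta>>0. \<exists>C\<in>G. prob (D - C \<union> (C - D)) < \<delta>)"
  using D
proof induction
  case (Basic D)
  then show ?case using G by (auto intro!: bexI[of _ D])
next
  case Empty
  interpret algebra "space M" G by fact
  show ?case by (auto intro!: bexI[of _ "{}"])
next
  case (Compl D)
  interpret algebra "space M" G by fact
  show ?case
  proof (intro conjI allI impI)
    show "space M - D \<in> events" using Compl by auto
    fix \<delta> :: real assume "\<delta> > 0"
    with Compl obtain C where C: "C \<in> G" "prob (D - C \<union> (C - D)) < \<delta>" by blast
    have "space M - D - (space M - C) \<union> (space M - C - (space M - D)) = D - C \<union> (C - D)"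
      using sets.sets_into_space[of D M] sets.sets_into_space[of C M] Compl C G(2) by blast
    with C show "\<exists>C\<in>G. prob (space M - D - C \<union> (C - (space M - D))) < \<delta>"
      by (intro bexI[of _ "space M - C"]) auto
  qed
next
  case (Union D)
  interpret algebra "space M" G by fact
  have D: "D i \<in> events" for i using Union by blast
  show ?case
  proof (intro conjI allI impI)
    show U: "\<Union> (range D) \<in> events" using D by blast
    fix \<delta> :: real assume \<delta>: "\<delta> > 0"
    have "(\<lambda>n. prob (\<Union>i<n. D i)) \<longlonglongrightarrow> prob (\<Union>n. \<Union>i<n. D i)"
      using D by (intro finite_Lim_measure_incseq) (force simp: incseq_def)+
    also have "(\<Union>n. \<Union>i<n. D i) = \<Union> (range D)" by blast
    finally have "\<forall>\<^sub>F n in sequentially. prob (\<Union> (range D)) - \<delta> / 2 < prob (\<Union>i<n. D i)"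
      using \<delta> by (intro order_tendstoD) auto
    then obtain n where n: "prob (\<Union> (range D)) - \<delta> / 2 < prob (\<Union>i<n. D i)"
      by (auto simp: eventually_sequentially)
    \<comment> \<open>At most n errors of this size add up to half of \<delta>; the added 1 covers n
      = 0.\<close>
    define e where "e = \<delta> / (2 * (real n + 1))"
    have "e > 0" using \<delta> by (simp add: e_def)
    with Union have "\<forall>i. \<exists>C. C \<in> G \<and> prob (D i - C \<union> (C - D i)) < e" by blast
    from choice[OF this] obtain C where C: "\<And>i. C i \<in> G" "\<And>i. prob (D i - C i \<union> (C i - D i)) < e"
      by blast
    have CE: "C i \<in> events" for i using C(1) G(2) by blast
    define V where "V = (\<Union>i<n. C i)"
    have "V \<in> G" unfolding V_def using C(1) by (intro finite_UN) auto
    have "prob (\<Union> (range D) - V \<union> (V - \<Union> (range D)))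
        \<le> prob ((\<Union> (range D) - (\<Union>i<n. D i)) \<union> (\<Union>i<n. D i - C i \<union> (C i - D i)))"
      using D CE U by (intro finite_measure_mono) (auto simp: V_def)
    also have "\<dots> \<le> prob (\<Union> (range D) - (\<Union>i<n. D i)) + prob (\<Union>i<n. D i - C i \<union> (C i - D i))"
      using D CE U by (intro measure_Un_le) auto
    also have "prob (\<Union> (range D) - (\<Union>i<n. D i)) = prob (\<Union> (range D)) - prob (\<Union>i<n. D i)"
      using D U by (intro finite_measure_Diff) auto
    also have "prob (\<Union>i<n. D i - C i \<union> (C i - D i)) \<le> (\<Sum>i<n. prob (D i - C i \<union> (C i - D i)))"
      using D CE by (intro finite_measure_subadditive_finite) auto
    also have "\<dots> \<le> (\<Sum>i<n. e)" using C(2) by (intro sum_mono less_imp_le)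
    also have "\<dots> \<le> \<delta> / 2" using \<delta> by (simp add: e_def field_simps)
    finally have "prob (\<Union> (range D) - V \<union> (V - \<Union> (range D))) < \<delta>" using n by linarith
    with \<open>V \<in> G\<close> show "\<exists>C\<in>G. prob (\<Union> (range D) - C \<union> (C - \<Union> (range D))) < \<delta>" by blast
  qed
qed

text \<open>If the complement D of A had positive probability, a set C of the algebra close to D
  would meet A in little more than nothing, against the lower bound e on the proportion of A in
  C.\<close>

lemma (in prob_space) prob_eq_1_if_uniform_lower_bound:
  assumes G: "algebra (space M) G" "G \<subseteq> events" "events \<subseteq> sigma_sets (space M) G"
    and A: "A \<in> events" and e: "e > 0" and le: "\<And>C. C \<in> G \<Longrightarrow> e * prob C \<le> prob (A \<inter> C)"
  shows "prob A = 1"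
proof (rule ccontr)
  assume "prob A \<noteq> 1"
  define D where "D = space M - A"
  have D: "D \<in> events" "prob D > 0"
    using A \<open>prob A \<noteq> 1\<close> prob_le_1[of A]
    by (simp_all add: D_def prob_compl order.strict_iff_order)
  \<comment> \<open>An approximation error \<delta> forces D to have probability at most \<delta> /
    e + \<delta> = \<delta> q; \<delta> is set so that this is half the probability of D.\<close>
  define q where "q = 1 / e + 1"
  have q: "q > 0" using e by (simp add: q_def add_pos_pos)
  define \<delta> where "\<delta> = prob D / (2 * q)"
  have \<delta>: "\<delta> > 0" using D q by (simp add: \<delta>_def)
  have "D \<in> sigma_sets (space M) G" using D G(3) by blast
  from sigma_sets_approximable[OF G(1,2) this] \<delta>
  obtain C where C: "C \<in> G" "prob (D - C \<union> (C - D)) < \<delta>" by blast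
  have CE: "C \<in> events" using C G by blast
  have "e * prob C \<le> prob (A \<inter> C)" using C(1) by (rule le)
  also have "\<dots> \<le> prob (D - C \<union> (C - D))"
    using D CE A by (intro finite_measure_mono) (auto simp: D_def)
  finally have "prob C \<le> \<delta> / e" using C(2) e by (simp add: field_simps)
  moreover have "prob D \<le> prob (C \<union> (D - C \<union> (C - D)))"
    using D CE by (intro finite_measure_mono) auto
  moreover have "\<dots> \<le> prob C + prob (D - C \<union> (C - D))"
    using D CE by (intro measure_Un_le) auto
  ultimately have "prob D \<le> \<delta> / e + \<delta>" using C(2) by linarith
  also have "\<delta> / e + \<delta> = \<delta> * q" by (simp add: q_def distrib_left)
  also have "\<dots> = prob D / 2" using q by (simp add: \<delta>_def)
  finally show False using D by simp
qed

section \<open>Events determined by finitely many steps\<close>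

definition agree3 where
  "agree3 n p q \<longleftrightarrow> (\<forall>i<n. fst p i = fst q i \<and> fst (snd p) i = fst (snd q) i \<and> snd (snd p) i = snd (snd q) i)"

definition cylinders :: "((nat \<Rightarrow> int ^ 3) \<times> (nat \<Rightarrow> int ^ 3) \<times> (nat \<Rightarrow> int ^ 3)) set set" where
  "cylinders = {C \<in> sets step_space3. \<exists>n. \<forall>p q. agree3 n p q \<longrightarrow> (p \<in> C \<longleftrightarrow> q \<in> C)}"

lemma algebra_cylinders: "algebra (space step_space3) cylinders"
proof (rule algebra_iff_Un[THEN iffD2], intro conjI ballI)
  show "cylinders \<subseteq> Pow (space step_space3)" by simp
  show "{} \<in> cylinders" by (simp add: cylinders_def)
  fix C assume "C \<in> cylinders"
  then obtain n where C: "C \<in> sets step_space3" and n: "\<forall>p q. agree3 n p q \<longrightarrow> (p \<in> C \<longleftrightarrow> q \<in> C)"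
    unfolding cylinders_def by blast
  have "space step_space3 - C \<in> sets step_space3" using C by (rule sets.compl_sets)
  moreover have "\<forall>p q. agree3 n p q \<longrightarrow> (p \<in> space step_space3 - C \<longleftrightarrow> q \<in> space step_space3 - C)"
    using n unfolding space_step_space3 by blast
  ultimately show "space step_space3 - C \<in> cylinders" unfolding cylinders_def by blast
  fix D assume "D \<in> cylinders"
  then obtain m where D: "D \<in> sets step_space3" and m: "\<forall>p q. agree3 m p q \<longrightarrow> (p \<in> D \<longleftrightarrow> q \<in> D)"
    unfolding cylinders_def by blast
  have "agree3 (max n m) p q \<Longrightarrow> agree3 n p q \<and> agree3 m p q"
    for p q :: "(nat \<Rightarrow> int ^ 3) \<times> (nat \<Rightarrow> int ^ 3) \<times> (nat \<Rightarrow> int ^ 3)"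
    unfolding agree3_def by simp
  with n m have "\<forall>p q. agree3 (max n m) p q \<longrightarrow> (p \<in> C \<union> D \<longleftrightarrow> q \<in> C \<union> D)" by blast
  with C D show "C \<union> D \<in> cylinders" unfolding cylinders_def by blast
qed

lemma measurable_step_spaceI:
  assumes "\<And>i. (\<lambda>\<omega>. f \<omega> i) \<in> M \<rightarrow>\<^sub>M count_space UNIV"
  shows "f \<in> M \<rightarrow>\<^sub>M step_space"
proof (rule measurable_PiM_single')
  show "(\<lambda>\<omega>. f \<omega> i) \<in> M \<rightarrow>\<^sub>M measure_pmf step_pmf" for i
    using assms[of i] by simp
qed (simp add: PiE_def)

text \<open>Each coordinate event is a cylinder, so the identity map from the generated space is
  measurable into \<open>step_space3\<close>; this is the inclusion.\<close>

lemma sets_step_space3_subset: "sets step_space3 \<subseteq> sigma_sets (space step_space3) cylinders"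
proof
  fix C assume C: "C \<in> sets step_space3"
  let ?S = "sigma (space step_space3) cylinders"
  have sub: "cylinders \<subseteq> Pow (space step_space3)" by simp
  have cyl: "{p. P p} \<in> sets ?S" if "{p. P p} \<in> cylinders" for P
    using that sub by (simp add: sets_measure_of)
  have coord: "(\<lambda>p. \<pi> p i) \<in> ?S \<rightarrow>\<^sub>M count_space UNIV"
    if "\<pi> \<in> {fst, \<lambda>p. fst (snd p), \<lambda>p. snd (snd p)}" for \<pi> i
  proof (rule measurableI)
    fix U :: "(int ^ 3) set"
    have "\<pi> \<in> step_space3 \<rightarrow>\<^sub>M step_space"
      using that by (auto intro: measurable_compose[OF measurable_snd])
    from measurable_sets[OF measurable_compose[OF this measurable_step], of U i]
    have "{p. \<pi> p i \<in> U} \<in> sets step_space3" by (simp add: vimage_def)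
    moreover have "agree3 (Suc i) p q \<Longrightarrow> \<pi> p i = \<pi> q i" for p q
      using that by (auto simp: agree3_def)
    then have "\<forall>p q. agree3 (Suc i) p q \<longrightarrow> (p \<in> {p. \<pi> p i \<in> U} \<longleftrightarrow> q \<in> {p. \<pi> p i \<in> U})" by simp
    ultimately have "{p. \<pi> p i \<in> U} \<in> cylinders" unfolding cylinders_def by blast
    then show "(\<lambda>p. \<pi> p i) -` U \<inter> space ?S \<in> sets ?S"
      using cyl sub by (simp add: vimage_def space_measure_of)
  qed simp
  have "(\<lambda>p. (fst p, (fst (snd p), snd (snd p)))) \<in> ?S \<rightarrow>\<^sub>M step_space3"
    by (intro measurable_Pair measurable_step_spaceI coord) auto
  from measurable_sets[OF this C] have "C \<in> sets ?S" using sub by (simp add: space_measure_of)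
  then show "C \<in> sigma_sets (space step_space3) cylinders" using sub by (simp add: sets_measure_of)
qed

definition comb3 where
  "comb3 n p q = (comb_seq n (fst p) (fst q),
    (comb_seq n (fst (snd p)) (fst (snd q)), comb_seq n (snd (snd p)) (snd (snd q))))"

lemma resamples_comb3: "resamples step_space3 (comb3 n)"
  using resamples_pair[OF steps.P.prob_space_axioms step_pair.P.prob_space_axioms resamples_comb_seq[of n]
      resamples_pair[OF steps.P.prob_space_axioms steps.P.prob_space_axioms resamples_comb_seq[of n] resamples_comb_seq[of n]]]
  by (simp add: comb3_def[abs_def])

lemma UNIV_in_sets_step_space3 [simp]: "UNIV \<in> sets step_space3"
  using sets.top[of step_space3] unfolding space_step_space3 .

text \<open>A cylinder C is unaffected by resampling all steps after its length n. Conditionally on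
  the first n steps the event W keeps probability at least \<open>1 / 2 ^ 18\<close>, hence it
  occupies at least this proportion of C.\<close>

lemma AE_triple_hit_all_boxes:
  "AE p in step_space3. \<forall>r. triple_hit (lattice_box r) (walk x (fst (snd p))) (walk y (snd (snd p))) (walk z (fst p))"
proof -
  define W where "W = (\<Inter>r. hit_event (lattice_box r) (walk x) (walk y) (walk z))"
  have W: "W \<in> sets step_space3"
    unfolding W_def by (intro sets.countable_INT'' sets_hit_event measurable_walk UNIV_in_sets_step_space3 countableI_type)
  have le: "1 / 2 ^ 18 * measure step_space3 C \<le> measure step_space3 (W \<inter> C)" if "C \<in> cylinders" for C
  proof -
    from that obtain n where C: "C \<in> sets step_space3" and n: "\<And>p q. agree3 n p q \<Longrightarrow> p \<in> C \<longleftrightarrow> q \<in> C"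
      by (auto simp: cylinders_def)
    have "agree3 n (comb3 n p q) p" for p q by (simp add: agree3_def comb3_def comb_seq_def)
    then have Cn: "comb3 n p q \<in> C \<longleftrightarrow> p \<in> C" for p q by (rule n)
    have "ennreal (1 / 2 ^ 18) * indicator C p \<le> (\<integral>\<^sup>+q. indicator (W \<inter> C) (comb3 n p q) \<partial>step_space3)" for p
    proof (cases "p \<in> C")
      case True
      define V where "V = (\<Inter>r. hit_event (lattice_box r) (\<lambda>s. walk x (comb_seq n (fst (snd p)) s))
        (\<lambda>s. walk y (comb_seq n (snd (snd p)) s)) (\<lambda>s. walk z (comb_seq n (fst p) s)))"
      have V: "V \<in> sets step_space3"
        unfolding V_def by (intro sets.countable_INT'' sets_hit_event measurable_walk_comb_seq UNIV_in_sets_step_space3 countableI_type)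
      \<comment> \<open>For fixed p in C, the event for the glued steps is V, in which the first n
        steps are those of p.\<close>
      have "indicator (W \<inter> C) (comb3 n p q) = (indicator V q :: ennreal)" for q
        using True Cn by (auto simp: indicator_def W_def V_def hit_event_def comb3_def)
      then have "(\<integral>\<^sup>+q. indicator (W \<inter> C) (comb3 n p q) \<partial>step_space3) = emeasure step_space3 V"
        using V by simp
      moreover have "1 / 2 ^ 18 \<le> measure step_space3 V"
        unfolding V_def by (rule prob_hit_all_boxes_lower_bound)
      ultimately show ?thesis
        using True by (simp add: step_triple.P.emeasure_eq_measure ennreal_leI)
    qed simp
    then have "(\<integral>\<^sup>+p. ennreal (1 / 2 ^ 18) * indicator C p \<partial>step_space3)
        \<le> (\<integral>\<^sup>+p. (\<integral>\<^sup>+q. indicator (W \<inter> C) (comb3 n p q) \<partial>step_space3) \<partial>step_space3)"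
      by (intro nn_integral_mono)
    also have "\<dots> = (\<integral>\<^sup>+p. indicator (W \<inter> C) p \<partial>step_space3)"
      by (rule nn_integral_resamples[OF resamples_comb3, symmetric])
        (rule borel_measurable_indicator[OF sets.Int[OF W C]])
    also have "\<dots> = emeasure step_space3 (W \<inter> C)" using W C by simp
    also have "(\<integral>\<^sup>+p. ennreal (1 / 2 ^ 18) * indicator C p \<partial>step_space3) = ennreal (1 / 2 ^ 18) * emeasure step_space3 C"
      using C by (rule nn_integral_cmult_indicator)
    finally have "ennreal (1 / 2 ^ 18 * measure step_space3 C) \<le> ennreal (measure step_space3 (W \<inter> C))"
      by (simp only: step_triple.P.emeasure_eq_measure) (subst ennreal_mult, auto)
    then show ?thesis by (subst (asm) ennreal_le_iff) simp_all
  qed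
  have "measure step_space3 W = 1"
    by (rule step_triple.P.prob_eq_1_if_uniform_lower_bound[OF algebra_cylinders _ sets_step_space3_subset W _ le])
      (auto simp: cylinders_def)
  then have "AE p in step_space3. p \<in> W"
    using W by (simp add: step_triple.P.prob_eq_1)
  then show ?thesis by (rule AE_mp) (auto simp: W_def hit_event_def)
qed

section \<open>Transfer from the given walks to the path space\<close>

definition increments :: "(nat \<Rightarrow> int ^ 3) \<Rightarrow> nat \<Rightarrow> int ^ 3" where
  "increments s n = s (Suc n) - s n"

lemma walk_increments: "walk (s 0) (increments s) n = s n"
  by (induction n) (simp_all add: walk_Suc increments_def)

abbreviation path_space :: "(nat \<Rightarrow> int ^ 3) measure" where
  "path_space \<equiv> \<Pi>\<^sub>M n\<in>UNIV. count_space UNIV"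

lemma sets_path_space: "sets path_space = sets step_space"
  by (rule sets_PiM_cong) simp_all

lemma measurable_increments: "increments \<in> path_space \<rightarrow>\<^sub>M path_space"
proof (rule measurable_PiM_single')
  fix n
  have 1: "(\<lambda>s. s n - a) \<in> path_space \<rightarrow>\<^sub>M count_space UNIV" for n a
    by (rule measurable_compose[OF measurable_component_singleton]) simp_all
  show "(\<lambda>s. increments s n) \<in> path_space \<rightarrow>\<^sub>M count_space UNIV"
    unfolding increments_def
    by (rule measurable_compose_countable[OF 1 measurable_component_singleton]) simp
qed (simp add: PiE_def space_PiM)

lemma distr_increments:
  assumes "prob_space M" "simple_random_walk M S x"
  shows "distr M path_space (\<lambda>\<omega>. increments (\<lambda>n. S n \<omega>)) = step_space"
proof -
  interpret prob_space M by fact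
  have rv: "random_variable (count_space UNIV) (\<lambda>\<omega>. S (Suc n) \<omega> - S n \<omega>)" for n
  proof -
    have S: "S n \<in> M \<rightarrow>\<^sub>M count_space UNIV" for n using assms(2) by (simp add: simple_random_walk_def)
    have "(\<lambda>\<omega>. S (Suc n) \<omega> - a) \<in> M \<rightarrow>\<^sub>M count_space UNIV" for a
      by (rule measurable_compose[OF S]) simp
    from measurable_compose_countable[OF this S] show ?thesis .
  qed
  have "distr M path_space (\<lambda>\<omega>. \<lambda>i\<in>UNIV. S (Suc i) \<omega> - S i \<omega>)
      = (\<Pi>\<^sub>M i\<in>UNIV. distr M (count_space UNIV) (\<lambda>\<omega>. S (Suc i) \<omega> - S i \<omega>))"
    using assms(2) rv
    by (subst indep_vars_iff_distr_eq_PiM[symmetric]) (simp_all add: simple_random_walk_def)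
  also have "\<dots> = step_space" using assms(2) by (simp add: simple_random_walk_def)
  finally show ?thesis by (simp add: increments_def[abs_def] restrict_UNIV)
qed

text \<open>Independence is stated for a family indexed by 0, 1, 2, whereas the estimates use nested
  pairs with Z in front; this identifies the two products.\<close>

lemma distr_step_space3_PiM:
  "distr step_space3 (\<Pi>\<^sub>M i\<in>{..<3}. step_space) (\<lambda>p. \<lambda>i\<in>{..<3}. [fst (snd p), snd (snd p), fst p] ! i)
    = (\<Pi>\<^sub>M i\<in>{..<3 :: nat}. step_space)" (is "distr _ ?P ?k = _")
proof -
  interpret product_sigma_finite "\<lambda>_ :: nat. step_space"
    by unfold_locales
  have lt3: "i < 3 \<longleftrightarrow> i = 0 \<or> i = 1 \<or> i = 2" for i :: nat by auto
  have all3: "(\<forall>i\<in>{..<3}. Q i) \<longleftrightarrow> Q 0 \<and> Q 1 \<and> Q 2" for Q :: "nat \<Rightarrow> bool"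
    unfolding Ball_def lessThan_iff lt3 by blast
  have k: "?k \<in> step_space3 \<rightarrow>\<^sub>M ?P"
    by (rule measurable_restrict) (auto simp: lt3 intro: measurable_compose[OF measurable_snd])
  show ?thesis
  proof (rule PiM_eqI)
    fix A :: "nat \<Rightarrow> (nat \<Rightarrow> int ^ 3) set" assume A: "\<And>i. i \<in> {..<3} \<Longrightarrow> A i \<in> sets step_space"
    have "?k -` (Pi\<^sub>E {..<3} A) \<inter> space step_space3 = A 2 \<times> (A 0 \<times> A 1)"
    proof (rule set_eqI)
      fix p
      have "?k p \<in> Pi\<^sub>E {..<3} A \<longleftrightarrow> (\<forall>i\<in>{..<3}. [fst (snd p), snd (snd p), fst p] ! i \<in> A i)"
        by (rule restrict_PiE_iff)
      then show "p \<in> ?k -` (Pi\<^sub>E {..<3} A) \<inter> space step_space3 \<longleftrightarrow> p \<in> A 2 \<times> (A 0 \<times> A 1)"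
        unfolding all3 by (simp add: mem_Times_iff conj_ac)
    qed
    moreover have "Pi\<^sub>E {..<3} A \<in> sets ?P" using A by (intro sets_PiM_I_finite) auto
    ultimately have "emeasure (distr step_space3 ?P ?k) (Pi\<^sub>E {..<3} A) = emeasure step_space3 (A 2 \<times> (A 0 \<times> A 1))"
      using k by (simp only: emeasure_distr)
    also have "\<dots> = emeasure step_space (A 2) * (emeasure step_space (A 0) * emeasure step_space (A 1))"
      using A by (simp add: step_pair.P.emeasure_pair_measure_Times steps.P.emeasure_pair_measure_Times)
    also have "\<dots> = (\<Prod>i\<in>{..<3}. emeasure step_space (A i))"
      by (simp add: numeral_3_eq_3 numeral_2_eq_2 mult_ac)
    finally show "emeasure (distr step_space3 ?P ?k) (Pi\<^sub>E {..<3} A) = (\<Prod>i\<in>{..<3}. emeasure step_space (A i))" .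
  qed simp_all
qed

lemma distr_increments_triple:
  assumes M: "prob_space M"
    and X: "simple_random_walk M X x" and Y: "simple_random_walk M Y y" and Z: "simple_random_walk M Z z"
    and ind: "independent_walks M X Y Z"
  defines "T \<equiv> \<lambda>\<omega>. (increments (\<lambda>n. Z n \<omega>), (increments (\<lambda>n. X n \<omega>), increments (\<lambda>n. Y n \<omega>)))"
  shows "T \<in> M \<rightarrow>\<^sub>M step_space3" and "distr M step_space3 T = step_space3"
proof -
  interpret prob_space M by fact
  let ?P = "\<Pi>\<^sub>M i\<in>{..<3 :: nat}. step_space"
  define F where "F = (\<lambda>(i :: nat) \<omega>. increments (\<lambda>n. ([X, Y, Z] ! i) n \<omega>))"
  have F: "indep_vars (\<lambda>_. path_space) F {..<3}"
    unfolding F_def using ind measurable_increments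
    by (intro indep_vars_compose2[where X = "\<lambda>i \<omega> n. ([X, Y, Z] ! i) n \<omega>" and Y = "\<lambda>_. increments"])
      (simp_all add: independent_walks_def)
  then have rvF: "F i \<in> M \<rightarrow>\<^sub>M path_space" if "i < 3" for i
    using that by (simp add: indep_vars_def)
  have lt3: "i < 3 \<longleftrightarrow> i = 0 \<or> i = 1 \<or> i = 2" for i :: nat by auto
  have distrF: "distr M path_space (F i) = step_space" if "i < 3" for i
    using that distr_increments[OF M X] distr_increments[OF M Y] distr_increments[OF M Z]
    by (auto simp: lt3 F_def)
  \<comment> \<open>As measures \<open>path_space\<close> and \<open>step_space\<close> differ, but
    their \<sigma>-algebras coincide, which is all that the target of \<open>distr\<close>
    uses.\<close>
  have sets_P: "sets (\<Pi>\<^sub>M i\<in>{..<3 :: nat}. path_space) = sets ?P"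
    by (intro sets_PiM_cong sets_path_space refl)
  define FF where "FF = (\<lambda>\<omega>. \<lambda>i\<in>{..<3}. F i \<omega>)"
  have "distr M ?P FF = distr M (\<Pi>\<^sub>M i\<in>{..<3 :: nat}. path_space) FF"
    by (intro distr_cong refl) (simp add: sets_P)
  also have "\<dots> = (\<Pi>\<^sub>M i\<in>{..<3}. distr M path_space (F i))"
  proof -
    have "{..<3 :: nat} \<noteq> {}" by (simp add: lessThan_empty_iff)
    from indep_vars_iff_distr_eq_PiM'[OF this, of F "\<lambda>_. path_space"] F rvF
    show ?thesis unfolding FF_def by simp
  qed
  also have "\<dots> = ?P" by (intro PiM_cong refl) (simp add: distrF)
  finally have FF: "distr M ?P FF = ?P" .
  have mFF: "FF \<in> M \<rightarrow>\<^sub>M ?P"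
    unfolding FF_def using rvF measurable_cong_sets[OF refl sets_path_space, of M] by (intro measurable_restrict) simp
  let ?k = "\<lambda>p :: (nat \<Rightarrow> int ^ 3) \<times> (nat \<Rightarrow> int ^ 3) \<times> (nat \<Rightarrow> int ^ 3). \<lambda>i\<in>{..<3}. [fst (snd p), snd (snd p), fst p] ! i"
  let ?h = "\<lambda>f :: nat \<Rightarrow> nat \<Rightarrow> int ^ 3. (f 2, (f 0, f 1))"
  have k: "?k \<in> step_space3 \<rightarrow>\<^sub>M ?P"
    by (rule measurable_restrict) (auto simp: lt3 intro: measurable_compose[OF measurable_snd])
  have h: "?h \<in> ?P \<rightarrow>\<^sub>M step_space3"
    by (intro measurable_Pair measurable_component_singleton) auto
  have T: "T = ?h \<circ> FF"
    by (simp add: T_def FF_def F_def fun_eq_iff)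
  show "T \<in> M \<rightarrow>\<^sub>M step_space3" unfolding T by (rule measurable_comp[OF mFF h])
  have "distr M step_space3 T = distr (distr M ?P FF) step_space3 ?h"
    unfolding T by (rule distr_distr[OF h mFF, symmetric])
  also have "distr M ?P FF = distr step_space3 ?P ?k"
    unfolding FF distr_step_space3_PiM ..
  also have "distr (distr step_space3 ?P ?k) step_space3 ?h = distr step_space3 step_space3 (?h \<circ> ?k)"
    by (rule distr_distr[OF h k])
  also have "?h \<circ> ?k = (\<lambda>p. p)" by (simp add: fun_eq_iff)
  finally show "distr M step_space3 T = step_space3" by simp
qed

theorem corollary1p5:
  fixes M :: "'w measure"
    and X Y Z :: "nat \<Rightarrow> 'w \<Rightarrow> int ^ 3"
    and x y z :: "int ^ 3"
  assumes "prob_space M"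
    and "simple_random_walk M X x"
    and "simple_random_walk M Y y"
    and "simple_random_walk M Z z"
    and "independent_walks M X Y Z"
  shows "AE \<omega> in M. infinite
           (range (partial_loop_erasure (range (\<lambda>k. Z k \<omega>)) (\<lambda>m. X m \<omega>))
            \<inter> range (\<lambda>n. Y n \<omega>) \<inter> range (\<lambda>k. Z k \<omega>))"
proof -
  let ?T = "\<lambda>\<omega>. (increments (\<lambda>n. Z n \<omega>), (increments (\<lambda>n. X n \<omega>), increments (\<lambda>n. Y n \<omega>)))"
  note T = distr_increments_triple[OF assms]
  have "AE p in distr M step_space3 ?T.
      \<forall>r. triple_hit (lattice_box r) (walk x (fst (snd p))) (walk y (snd (snd p))) (walk z (fst p))"
    unfolding T(2) by (rule AE_triple_hit_all_boxes)
  from AE_distrD[OF T(1) this]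
  have "AE \<omega> in M. \<forall>r. triple_hit (lattice_box r) (walk x (increments (\<lambda>n. X n \<omega>)))
      (walk y (increments (\<lambda>n. Y n \<omega>))) (walk z (increments (\<lambda>n. Z n \<omega>)))" by simp
  moreover have "AE \<omega> in M. X 0 \<omega> = x" "AE \<omega> in M. Y 0 \<omega> = y" "AE \<omega> in M. Z 0 \<omega> = z"
    using assms by (simp_all add: simple_random_walk_def)
  ultimately show ?thesis
  proof eventually_elim
    case (elim \<omega>)
    \<comment> \<open>The paths are recovered from their increments where the starting points are
      the prescribed ones, which holds almost surely.\<close>
    have "walk x (increments (\<lambda>n. X n \<omega>)) = (\<lambda>n. X n \<omega>)" "walk y (increments (\<lambda>n. Y n \<omega>)) = (\<lambda>n. Y n \<omega>)"
      "walk z (increments (\<lambda>n. Z n \<omega>)) = (\<lambda>n. Z n \<omega>)"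
      using walk_increments[of "\<lambda>n. X n \<omega>"] walk_increments[of "\<lambda>n. Y n \<omega>"] walk_increments[of "\<lambda>n. Z n \<omega>"] elim
      by (auto simp: fun_eq_iff)
    with elim show ?case by (intro infinite_if_triple_hit_all_boxes) simp
  qed
qed

end
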